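(* There is a rank-one free infinite measure preserving action $T$ of the discrete Heisenberg group $H_3(\mathbb Z)$ such that $\mathcal R(T)=\{\theta_l\mid l\in\mathbb Z\}\cup\{\theta_\infty\}$. Therefore $\mathcal{ER}(T)=\{\theta_\infty\}$ and hence $\mathcal R(T)\ne\mathcal{ER}(T)$.
   Context: $H_3(\mathbb R)$ is the group of real upper triangular $3\times3$ matrices with ones on the diagonal, $H_3(\mathbb Z)$ its subgroup (a lattice) of matrices with integer entries, and $\mathfrak h_3(\mathbb R)$ the Lie algebra of $H_3(\mathbb R)$ (strictly upper triangular real $3\times 3$ matrices). $P(\mathfrak h_3(\mathbb R))$ is the set of lines (1-dimensional linear subspaces) in $\mathfrak h_3(\mathbb R)$; $H_3(\mathbb R)$ acts on it via the adjoint representation. For a line $\theta$, $\exp(\theta)=\{\exp(v):v\in\theta\}\subset H_3(\mathbb R)$. A right-invariant metric $\mathrm{dist}$ on $H_3(\mathbb R)$ compatible with the topology is fixed. For $t\in\mathbb R$, $\theta_t$ is the line spanned by $\begin{pmatrix}0&1&t\\0&0&0\\0&0&0\end{pmatrix}$, and $\theta_\infty$ is the line spanned by $\begin{pmatrix}0&0&1\\0&0&0\\0&0&0\end{pmatrix}$. Actions are measure preserving actions $T=(T_\gamma)_{\gamma\in H_3(\mathbb Z)}$ on $\sigma$-finite standard measure spaces $(X,\mathfrak B,\mu)$; infinite measure preserving means $\mu(X)=\infty$; free means that for each $\gamma\ne1$, $T_\gamma x\ne x$ for a.e. $x$. $T$ is recurrent along $\theta$ if for each $\epsilon>0$ and every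 $A\in\mathfrak B$ with $\mu(A)>0$ there are $\gamma\in H_3(\mathbb Z)\setminus\{1\}$ and $g\in\exp(\theta)$ such that $\mathrm{dist}(\gamma,g)<\epsilon$ and $\mu(A\cap T_\gamma A)>0$. $\mathcal R(T)$ is the set of all $\theta\in P(\mathfrak h_3(\mathbb R))$ such that $T$ is recurrent along $\theta$. $T$ is evenly recurrent along $\theta$ if $T$ is recurrent along every line from the $H_3(\mathbb R)$-orbit of $\theta$; $\mathcal{ER}(T)$ is the set of all $\theta$ such that $T$ is evenly recurrent along $\theta$. Rank one: there are a Følner sequence $(F_n)$ of finite subsets of $H_3(\mathbb Z)$ and measurable sets $B_n\subset X$ with $0<\mu(B_n)<\infty$ such that for each $n$ the sets $T_\gamma B_n$, $\gamma\in F_n$, are pairwise disjoint, and for every measurable $A\subset X$ with $\mu(A)<\infty$, $\lim_{n\to\infty}\min_{F\subset F_n}\mu\big(A\,\triangle\,\bigsqcup_{\gamma\in F}T_\gamma B_n\big)=0$. *)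

theory Defs
  imports "HOL-Analysis.Analysis"
begin

section \<open>The Heisenberg group, its lattice and its Lie algebra\<close>

text \<open>
  The index type \<open>3\<close> satisfies \<open>3 = 0\<close>, so its built-in order is not the order \<open>1, 2, 3\<close> of rows
  and columns; the triangularity conditions are therefore spelled out entrywise.
\<close>

definition H3R :: "(real^3^3) set" where
  "H3R = {g. g $ 1 $ 1 = 1 \<and> g $ 2 $ 2 = 1 \<and> g $ 3 $ 3 = 1 \<and>
             g $ 2 $ 1 = 0 \<and> g $ 3 $ 1 = 0 \<and> g $ 3 $ 2 = 0}"

definition H3Z :: "(real^3^3) set" where
  "H3Z = {g \<in> H3R. \<forall>i j. g $ i $ j \<in> \<int>}"

definition h3R :: "(real^3^3) set" where
  "h3R = {v. v $ 1 $ 1 = 0 \<and> v $ 2 $ 2 = 0 \<and> v $ 3 $ 3 = 0 \<and>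
             v $ 2 $ 1 = 0 \<and> v $ 3 $ 1 = 0 \<and> v $ 3 $ 2 = 0}"

text \<open>
  Matrices \<open>real^'n^'n\<close> form no ring type class (the product \<open>*\<close> is componentwise), so the
  library's \<open>exp\<close> and \<open>^\<close> do not apply to them.
\<close>

definition mat_exp :: "real^'n^'n \<Rightarrow> real^'n^'n" where
  "mat_exp v = (\<Sum>n. (1 / fact n) *\<^sub>R (((\<lambda>w. v ** w) ^^ n) (mat 1)))"

definition Ad :: "real^3^3 \<Rightarrow> real^3^3 \<Rightarrow> real^3^3" where
  "Ad g v = g ** v ** matrix_inv g"

definition P_h3R :: "(real^3^3) set set" where
  "P_h3R = {\<theta>. subspace \<theta> \<and> \<theta> \<subseteq> h3R \<and> dim \<theta> = 1}"

definition Ad_orbit :: "(real^3^3) set \<Rightarrow> (real^3^3) set set" where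
  "Ad_orbit \<theta> = {Ad g ` \<theta> | g. g \<in> H3R}"

definition theta :: "real \<Rightarrow> (real^3^3) set" where
  "theta t = span {vector [vector [0, 1, t], vector [0, 0, 0], vector [0, 0, 0]]}"

definition theta_inf :: "(real^3^3) set" where
  "theta_inf = span {vector [vector [0, 0, 1], vector [0, 0, 0], vector [0, 0, 0]]}"

definition right_invariant_metric :: "(real^3^3 \<Rightarrow> real^3^3 \<Rightarrow> real) \<Rightarrow> bool" where
  "right_invariant_metric d \<longleftrightarrow>
     Metric_space H3R d \<and>
     Metric_space.mtopology H3R d = top_of_set H3R \<and>
     (\<forall>x\<in>H3R. \<forall>y\<in>H3R. \<forall>z\<in>H3R. d (x ** z) (y ** z) = d x y)"


section \<open>Measure preserving actions\<close>

definition standard_measure_space :: "'a measure \<Rightarrow> bool" where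
  "standard_measure_space M \<longleftrightarrow>
     sigma_finite_measure M \<and>
     (\<exists>X. topspace X = space M \<and> completely_metrizable_space X \<and> second_countable X \<and>
          sets M = sigma_sets (space M) {U. openin X U})"

definition mp_action :: "'a measure \<Rightarrow> (real^3^3 \<Rightarrow> 'a \<Rightarrow> 'a) \<Rightarrow> bool" where
  "mp_action M T \<longleftrightarrow>
     standard_measure_space M \<and>
     (\<forall>\<gamma>\<in>H3Z. T \<gamma> \<in> measurable M M \<and> distr M M (T \<gamma>) = M) \<and>
     (\<forall>x\<in>space M. T (mat 1) x = x) \<and>
     (\<forall>\<gamma>\<in>H3Z. \<forall>\<delta>\<in>H3Z. \<forall>x\<in>space M. T (\<gamma> ** \<delta>) x = T \<gamma> (T \<delta> x))"

definition free_action :: "'a measure \<Rightarrow> (real^3^3 \<Rightarrow> 'a \<Rightarrow> 'a) \<Rightarrow> bool" where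
  "free_action M T \<longleftrightarrow> (\<forall>\<gamma>\<in>H3Z - {mat 1}. AE x in M. T \<gamma> x \<noteq> x)"

text \<open>
  Left Folner sequences: \<open>T \<delta>\<close> maps the level \<open>T \<gamma> ` B\<close> of a tower to the level
  \<open>T (\<delta> ** \<gamma>) ` B\<close>, so left translates are the relevant ones.
\<close>

definition Folner_sequence :: "(nat \<Rightarrow> (real^3^3) set) \<Rightarrow> bool" where
  "Folner_sequence F \<longleftrightarrow>
     (\<forall>n. finite (F n) \<and> F n \<noteq> {} \<and> F n \<subseteq> H3Z) \<and>
     (\<forall>\<gamma>\<in>H3Z. (\<lambda>n. real (card (sym_diff ((\<lambda>\<delta>. \<gamma> ** \<delta>) ` F n) (F n))) / real (card (F n)))
        \<longlonglongrightarrow> 0)"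

definition rank_one :: "'a measure \<Rightarrow> (real^3^3 \<Rightarrow> 'a \<Rightarrow> 'a) \<Rightarrow> bool" where
  "rank_one M T \<longleftrightarrow>
     (\<exists>F B. Folner_sequence F \<and>
        (\<forall>n. B n \<in> sets M \<and> 0 < emeasure M (B n) \<and> emeasure M (B n) < \<infinity> \<and>
             disjoint_family_on (\<lambda>\<gamma>. T \<gamma> ` B n) (F n)) \<and>
        (\<forall>A\<in>sets M. emeasure M A < \<infinity> \<longrightarrow>
           (\<lambda>n. Min ((\<lambda>E. emeasure M (sym_diff A (\<Union>\<gamma>\<in>E. T \<gamma> ` B n))) ` Pow (F n)))
             \<longlonglongrightarrow> 0))"


section \<open>Directional recurrence\<close>

definition recurrent_along ::
  "(real^3^3 \<Rightarrow> real^3^3 \<Rightarrow> real) \<Rightarrow> 'a measure \<Rightarrow> (real^3^3 \<Rightarrow> 'a \<Rightarrow> 'a) \<Rightarrow> (real^3^3) set \<Rightarrow> bool"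
  where
  "recurrent_along d M T \<theta> \<longleftrightarrow>
     (\<forall>\<epsilon>>0. \<forall>A\<in>sets M. 0 < emeasure M A \<longrightarrow>
        (\<exists>\<gamma>\<in>H3Z - {mat 1}. \<exists>g\<in>mat_exp ` \<theta>. d \<gamma> g < \<epsilon> \<and> 0 < emeasure M (A \<inter> T \<gamma> ` A)))"

definition recurrence_set ::
  "(real^3^3 \<Rightarrow> real^3^3 \<Rightarrow> real) \<Rightarrow> 'a measure \<Rightarrow> (real^3^3 \<Rightarrow> 'a \<Rightarrow> 'a) \<Rightarrow> (real^3^3) set set"
  where
  "recurrence_set d M T = {\<theta> \<in> P_h3R. recurrent_along d M T \<theta>}"

definition evenly_recurrent_along ::
  "(real^3^3 \<Rightarrow> real^3^3 \<Rightarrow> real) \<Rightarrow> 'a measure \<Rightarrow> (real^3^3 \<Rightarrow> 'a \<Rightarrow> 'a) \<Rightarrow> (real^3^3) set \<Rightarrow> bool"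
  where
  "evenly_recurrent_along d M T \<theta> \<longleftrightarrow> (\<forall>\<theta>'\<in>Ad_orbit \<theta>. recurrent_along d M T \<theta>')"

definition even_recurrence_set ::
  "(real^3^3 \<Rightarrow> real^3^3 \<Rightarrow> real) \<Rightarrow> 'a measure \<Rightarrow> (real^3^3 \<Rightarrow> 'a \<Rightarrow> 'a) \<Rightarrow> (real^3^3) set set"
  where
  "even_recurrence_set d M T = {\<theta> \<in> P_h3R. evenly_recurrent_along d M T \<theta>}"

end

theory Submission
  imports Defs "HOL-Library.Countable" "HOL-Real_Asymp.Real_Asymp"
begin

text \<open>
  The action is obtained by cutting and stacking. Stage \<open>n\<close> is a tower of disjoint intervals of length
  \<open>2\<^sup>-\<^sup>n\<close> labelled by a box \<open>F n\<close> in the lattice, on which the group acts by left translation of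
  labels. Each interval labelled \<open>f\<close> is halved, the halves being labelled \<open>f\<close> and \<open>f c\<^sub>n\<close>, and new
  intervals fill up the next box. The \<open>c\<^sub>n\<close> grow rapidly; each is either central or lies on a line of
  integer slope \<open>l\<close> in the abelian subgroup without \<open>(2,3)\<close>-entry, and every direction is used infinitely
  often.

  A set that fills most of the level \<open>f\<close> returns under \<open>f c\<^sub>n f\<^sup>-\<^sup>1\<close>, whose slope is \<open>l\<close> minus the
  \<open>(2,3)\<close>-entry of \<open>f\<close>. Right multiplication by \<open>c\<^sub>n\<close> preserves that entry, so every integer slope and the
  centre are recurrent. Conversely the returns to the level of the identity at stage \<open>n\<close> differ from some
  \<open>c\<^sub>j\<close> or \<open>c\<^sub>j\<^sup>-\<^sup>1\<close>, \<open>j \<ge> n\<close>, by an error that is small compared with \<open>c\<^sub>j\<close>, hence stay away from any line of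
  non-integer slope; and lines outside the abelian subgroup meet a neighbourhood of it only near the
  identity.
\<close>

section \<open>Cutting and stacking over a countable group\<close>

text \<open>\<open>F n\<close> is the label set of stage \<open>n\<close>. \<open>F_disjoint\<close>
  gives the second halves labels that no first half uses. \<open>F_absorbs\<close> makes each fixed
  \<open>g\<close> eventually translate both halves of every level within the next stage, so that
  \<open>g\<close> acts everywhere in the limit. Countability lets labels be encoded as
  integers.\<close>

locale cut_and_stack =
  fixes F :: "nat \<Rightarrow> 'g::{group_add,countable} set" and c :: "nat \<Rightarrow> 'g"
  assumes finite_F: "finite (F n)"
    and zero_F: "0 \<in> F n"
    and F_Suc: "f \<in> F n \<Longrightarrow> f \<in> F (Suc n)"
    and F_shift: "f \<in> F n \<Longrightarrow> f + c n \<in> F (Suc n)"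
    and F_disjoint: "f \<in> F n \<Longrightarrow> f + c n \<notin> F n"
    and F_absorbs: "\<exists>N. \<forall>n\<ge>N. \<forall>f\<in>F n. g + f \<in> F (Suc n) \<and> g + f + c n \<in> F (Suc n)"
begin

text \<open>A level that is new at stage \<open>n\<close> starts at an integer encoding its stage and label, so that distinct
  new levels lie in distinct unit intervals.\<close>

fun left_end :: "nat \<Rightarrow> 'g \<Rightarrow> real" where
  "left_end 0 f = real (to_nat (0::nat, f))"
| "left_end (Suc n) f =
     (if f \<in> F n then left_end n f
      else if f - c n \<in> F n then left_end n (f - c n) + (1/2) ^ Suc n
      else real (to_nat (Suc n, f)))"

text \<open>Half-open, so that halving is an exact partition.\<close>

definition level :: "nat \<Rightarrow> 'g \<Rightarrow> real set" where
  "level n f = {left_end n f ..< left_end n f + (1/2) ^ n}"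

definition stage :: "nat \<Rightarrow> real set" where
  "stage n = (\<Union>f\<in>F n. level n f)"

definition carrier :: "real set" where
  "carrier = (\<Union>n. stage n)"

section \<open>Nesting and disjointness of the levels\<close>

lemma left_end_shift: "f \<in> F n \<Longrightarrow> left_end (Suc n) (f + c n) = left_end n f + (1/2) ^ Suc n"
  using F_disjoint[of f n] by simp

lemma level_split:
  assumes "f \<in> F n"
  shows "level n f = level (Suc n) f \<union> level (Suc n) (f + c n)"
    "level (Suc n) f \<inter> level (Suc n) (f + c n) = {}"
  using assms left_end_shift[OF assms] by (auto simp: level_def simp del: left_end.simps(2))
    simp_all

lemma level_Suc_cases:
  assumes "f \<in> F (Suc n)"
  obtains "f \<in> F n" | f' where "f' \<in> F n" "f = f' + c n"
  | "f \<notin> F n" "f - c n \<notin> F n" "left_end (Suc n) f = real (to_nat (Suc n, f))"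
  by (metis diff_add_cancel left_end.simps(2))

text \<open>A new level starts at an integer and has length at most 1, and later stages only halve
  it. Hence the integer part of a point remembers the stage and label at which its ancestor level
  was created.\<close>

lemma level_birth:
  assumes "f \<in> F n" "x \<in> level n f"
  shows "\<exists>m h. m \<le> n \<and> \<lfloor>x\<rfloor> = int (to_nat (m, h :: 'g))"
  using assms
proof (induction n arbitrary: f)
  case 0
  then have "\<lfloor>x\<rfloor> = int (to_nat (0::nat, f))"
    by (simp add: level_def floor_eq_iff)
  then show ?case by blast
next
  case (Suc n)
  from Suc.prems(1) show ?case
  proof (cases rule: level_Suc_cases)
    case 1
    then have "x \<in> level n f" using Suc.prems level_split(1)[OF 1] by blast
    then show ?thesis using Suc.IH[OF 1] le_SucI by blast
  next
    case (2 f')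
    then have "x \<in> level n f'" using Suc.prems level_split(1)[OF 2(1)] by blast
    then show ?thesis using Suc.IH[OF 2(1)] le_SucI by blast
  next
    case 3
    have "(1/2::real) ^ Suc n \<le> 1" by (rule power_le_one) auto
    with 3(3) Suc.prems(2) have "\<lfloor>x\<rfloor> = int (to_nat (Suc n, f))"
      by (simp add: level_def floor_eq_iff del: left_end.simps)
    then show ?thesis by blast
  qed
qed

text \<open>The integer part of \<open>x\<close> tells whether its level is new at this stage. New
  levels with the same integer part have the same label, since \<open>to_nat\<close> is injective;
  old ones have the same parent by induction, and the halves of one parent are disjoint.\<close>

lemma level_disjoint:
  assumes "f \<in> F n" "h \<in> F n" "x \<in> level n f" "x \<in> level n h"
  shows "f = h"
  using assms
proof (induction n arbitrary: f h)
  case 0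
  then have "real (to_nat (0::nat, f)) < real (to_nat (0::nat, h)) + 1"
    "real (to_nat (0::nat, h)) < real (to_nat (0::nat, f)) + 1" by (auto simp: level_def)
  then have "to_nat (0::nat, f) = to_nat (0::nat, h)" by linarith
  then show ?case by simp
next
  case (Suc n)
  have old: "\<exists>f'\<in>F n. x \<in> level n f' \<and> (f = f' \<or> f = f' + c n)"
    if "f \<in> F (Suc n)" "x \<in> level (Suc n) f" "\<lfloor>x\<rfloor> \<noteq> int (to_nat (Suc n, f))" for f
    using that(1)
  proof (cases rule: level_Suc_cases)
    case 1
    then show ?thesis using that level_split(1)[OF 1] by blast
  next
    case (2 f')
    then show ?thesis using that level_split(1)[OF 2(1)] by blast
  next
    case 3
    have "(1/2::real) ^ Suc n \<le> 1" by (rule power_le_one) auto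
    with 3(3) that(2) have "\<lfloor>x\<rfloor> = int (to_nat (Suc n, f))"
      by (simp add: level_def floor_eq_iff del: left_end.simps)
    then show ?thesis using that by blast
  qed
  have new: "\<lfloor>x\<rfloor> \<noteq> int (to_nat (Suc n, g))" if f': "f' \<in> F n" "x \<in> level n f'" for f' and g :: 'g
  proof
    assume "\<lfloor>x\<rfloor> = int (to_nat (Suc n, g))"
    moreover obtain m h where "m \<le> n" "\<lfloor>x\<rfloor> = int (to_nat (m, h :: 'g))"
      using level_birth[OF f'] by blast
    ultimately have "(Suc n, g) = (m, h)" "m \<le> n" by (simp_all del: prod.inject)
    then show False by simp
  qed
  show ?case
  proof (cases "\<lfloor>x\<rfloor> = int (to_nat (Suc n, f)) \<or> \<lfloor>x\<rfloor> = int (to_nat (Suc n, h))")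
    case True
    then have "\<lfloor>x\<rfloor> = int (to_nat (Suc n, f))" "\<lfloor>x\<rfloor> = int (to_nat (Suc n, h))"
      using old[OF Suc.prems(1,3)] old[OF Suc.prems(2,4)] new by blast+
    then show ?thesis by simp
  next
    case False
    then obtain f' h' where fh: "f' \<in> F n" "x \<in> level n f'" "f = f' \<or> f = f' + c n"
      "h' \<in> F n" "x \<in> level n h'" "h = h' \<or> h = h' + c n"
      using old[OF Suc.prems(1,3)] old[OF Suc.prems(2,4)] by blast
    then have "f' = h'" using Suc.IH by blast
    then show ?thesis using fh level_split(2)[OF fh(1)] Suc.prems by blast
  qed
qed

lemma stage_Suc: "stage n \<subseteq> stage (Suc n)"
proof
  fix x assume "x \<in> stage n"
  then obtain f where f: "f \<in> F n" "x \<in> level n f" by (auto simp: stage_def)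
  then show "x \<in> stage (Suc n)"
    using level_split(1)[OF f(1)] F_Suc[OF f(1)] F_shift[OF f(1)] unfolding stage_def by blast
qed

lemma incseq_stage: "incseq stage"
  using stage_Suc by (rule incseq_SucI)

text \<open>Once the preceding stage contains \<open>x\<close> and is past the threshold of
  \<open>F_absorbs\<close>, both halves of the level of \<open>x\<close> get labels that
  \<open>g\<close> keeps inside the next stage.\<close>

lemma stage_eventually:
  assumes "x \<in> carrier"
  shows "\<exists>N. \<forall>n\<ge>N. \<exists>f\<in>F n. x \<in> level n f \<and> g + f \<in> F n"
proof -
  obtain n0 where n0: "x \<in> stage n0" using assms by (auto simp: carrier_def)
  obtain N where N: "\<forall>n\<ge>N. \<forall>f\<in>F n. g + f \<in> F (Suc n) \<and> g + f + c n \<in> F (Suc n)"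
    using F_absorbs by blast
  have "\<exists>f\<in>F n. x \<in> level n f \<and> g + f \<in> F n" if n: "n \<ge> Suc (max N n0)" for n
  proof -
    obtain m where m: "n = Suc m" using n by (cases n) auto
    have "x \<in> stage m" using n0 incseqD[OF incseq_stage, of n0 m] n m by auto
    then obtain f where f: "f \<in> F m" "x \<in> level m f" by (auto simp: stage_def)
    then have "g + f \<in> F n" "g + (f + c m) \<in> F n" "f \<in> F n" "f + c m \<in> F n"
      using N n m F_Suc F_shift by (auto simp: add.assoc)
    then show ?thesis using level_split(1)[OF f(1)] f m by blast
  qed
  then show ?thesis by blast
qed

section \<open>The limit action\<close>

definition moves :: "'g \<Rightarrow> nat \<Rightarrow> real \<Rightarrow> real \<Rightarrow> bool" where
  "moves g n x y \<longleftrightarrow>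
     (\<exists>f\<in>F n. x \<in> level n f \<and> g + f \<in> F n \<and> y = x - left_end n f + left_end n (g + f))"

text \<open>Left translation by \<open>g\<close> commutes with right multiplication by
  \<open>c n\<close>, so corresponding halves go to corresponding halves by the same translation.
  The partial maps of successive stages therefore extend one another.\<close>

lemma moves_Suc:
  assumes "moves g n x y"
  shows "moves g (Suc n) x y"
proof -
  obtain f where f: "f \<in> F n" "x \<in> level n f" "g + f \<in> F n"
    "y = x - left_end n f + left_end n (g + f)" using assms by (auto simp: moves_def)
  consider "x \<in> level (Suc n) f" | "x \<in> level (Suc n) (f + c n)" using level_split(1) f by blast
  then show ?thesis
  proof cases
    case 1
    then show ?thesis using f F_Suc by (auto simp: moves_def intro!: bexI[of _ f])
  next
    case 2
    then show ?thesis
      using f F_shift[of f n] F_shift[of "g + f" n] left_end_shift[of f n] left_end_shift[of "g + f" n]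
      by (auto simp: moves_def add.assoc simp del: left_end.simps intro!: bexI[of _ "f + c n"])
  qed
qed

lemma moves_mono: "moves g n x y \<Longrightarrow> n \<le> m \<Longrightarrow> moves g m x y"
  by (induction m) (auto simp: le_Suc_eq moves_Suc)

lemma moves_unique:
  assumes "moves g n x y" "moves g m x z"
  shows "y = z"
  using moves_mono[OF assms(1), of "max n m"] moves_mono[OF assms(2), of "max n m"]
  by (auto simp: moves_def dest: level_disjoint)

text \<open>The common extension of the partial maps: the value is unique by
  \<open>moves_unique\<close>, and on \<open>carrier\<close> it exists by
  \<open>stage_eventually\<close>.\<close>

definition act :: "'g \<Rightarrow> real \<Rightarrow> real" where
  "act g x = (if x \<in> carrier then THE y. \<exists>n. moves g n x y else x)"

lemma act_eq:
  assumes "f \<in> F n" "x \<in> level n f" "g + f \<in> F n"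
  shows "act g x = x - left_end n f + left_end n (g + f)"
proof -
  have *: "moves g n x (x - left_end n f + left_end n (g + f))"
    using assms by (auto simp: moves_def)
  have "x \<in> carrier" using assms by (auto simp: carrier_def stage_def)
  then show ?thesis unfolding act_def using * moves_unique by (auto intro!: the_equality)
qed

lemma act_level_mem:
  assumes "f \<in> F n" "x \<in> level n f" "g + f \<in> F n"
  shows "act g x \<in> level n (g + f)"
  using act_eq[OF assms] assms(2) by (auto simp: level_def)

lemma level_carrier: "f \<in> F n \<Longrightarrow> level n f \<subseteq> carrier"
  by (auto simp: carrier_def stage_def)

lemma act_zero: "act 0 x = x"
proof (cases "x \<in> carrier")
  case True
  then obtain n f where "f \<in> F n" "x \<in> level n f" by (auto simp: carrier_def stage_def)
  then show ?thesis using act_eq[of f n x 0] by simp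
qed (simp add: act_def)

text \<open>At a late stage the label \<open>f\<close> of the level of \<open>x\<close> has both
  \<open>h + f\<close> and \<open>(g + h) + f\<close> in \<open>F n\<close>; there the action law is
  associativity for labels.\<close>

lemma act_add: "act (g + h) x = act g (act h x)"
proof (cases "x \<in> carrier")
  case True
  obtain N where N: "\<forall>n\<ge>N. \<exists>f\<in>F n. x \<in> level n f \<and> h + f \<in> F n"
    using stage_eventually[OF True] by blast
  obtain N' where N': "\<forall>n\<ge>N'. \<exists>f\<in>F n. x \<in> level n f \<and> (g + h) + f \<in> F n"
    using stage_eventually[OF True] by blast
  define n where "n = max N N'"
  obtain f where f: "f \<in> F n" "x \<in> level n f" "h + f \<in> F n"
    using N n_def by (meson max.cobounded1)
  obtain f' where f': "f' \<in> F n" "x \<in> level n f'" "(g + h) + f' \<in> F n"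
    using N' n_def by (meson max.cobounded2)
  have "f' = f" using f f' level_disjoint by blast
  then show ?thesis
    using f f' act_eq[of f n x "g + h"] act_eq[of f n x h] act_level_mem[of f n x h]
      act_eq[of "h + f" n "act h x" g] by (simp add: add.assoc)
qed (simp add: act_def)

lemma act_inverse: "act (- g) (act g x) = x" "act g (act (- g) x) = x"
  by (simp_all flip: act_add add: act_zero)

lemma act_level:
  assumes "f \<in> F n" "g + f \<in> F n"
  shows "act g ` level n f = level n (g + f)"
proof
  show "act g ` level n f \<subseteq> level n (g + f)" using assms act_level_mem by blast
  have "act (- g) ` level n (g + f) \<subseteq> level n f"
    using assms act_level_mem[of "g + f" n _ "- g"] by (auto simp: add.assoc[symmetric])
  then show "level n (g + f) \<subseteq> act g ` level n f"
    by (metis act_inverse(2) image_eqI image_subset_iff subsetI)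
qed

lemma act_fixed_point:
  assumes "x \<in> carrier" "act g x = x"
  shows "g = 0"
proof -
  obtain n f where f: "f \<in> F n" "x \<in> level n f" "g + f \<in> F n"
    using stage_eventually[of x g] assms by blast
  have "g + f = f"
    using act_level_mem[OF f] f assms(2) by (intro level_disjoint[of _ n _ x]) auto
  then show ?thesis by (metis add_0 add_right_cancel)
qed

text \<open>Points outside \<open>carrier\<close> are fixed by \<open>act\<close>; they form a null set of \<open>M\<close>.\<close>

definition M :: "real measure" where
  "M = density lborel (indicator carrier)"

section \<open>Measurability and invariance of the measure\<close>

lemma level_borel [measurable]: "level n f \<in> sets borel"
  by (simp add: level_def)

lemma stage_borel [measurable]: "stage n \<in> sets borel"
  unfolding stage_def using finite_F by (intro sets.finite_UN) auto

lemma carrier_borel [measurable]: "carrier \<in> sets borel"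
  unfolding carrier_def by (intro sets.countable_UN) auto

lemma space_M [simp]: "space M = UNIV" and sets_M [simp, measurable_cong]: "sets M = sets borel"
  by (simp_all add: M_def)

lemma emeasure_M: "A \<in> sets borel \<Longrightarrow> emeasure M A = emeasure lborel (carrier \<inter> A)"
  by (simp add: M_def emeasure_restricted)

lemma emeasure_M_sub: "A \<in> sets borel \<Longrightarrow> A \<subseteq> carrier \<Longrightarrow> emeasure M A = emeasure lborel A"
  by (simp add: emeasure_M Int_absorb1)

lemma emeasure_level: "f \<in> F n \<Longrightarrow> emeasure M (level n f) = ennreal ((1/2) ^ n)"
  using level_carrier[of f n] by (simp add: emeasure_M_sub level_def)

lemma level_disjoint_family: "disjoint_family_on (level n) (F n)"
  using level_disjoint by (auto simp: disjoint_family_on_def)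

lemma emeasure_levels:
  assumes "E \<subseteq> F n"
  shows "emeasure M (\<Union>f\<in>E. level n f) = ennreal (card E * (1/2) ^ n)"
proof -
  have "emeasure M (\<Union>f\<in>E. level n f) = (\<Sum>f\<in>E. emeasure M (level n f))"
    using finite_subset[OF assms finite_F] disjoint_family_on_mono[OF assms level_disjoint_family]
    by (intro sum_emeasure[symmetric]) auto
  also have "\<dots> = (\<Sum>f\<in>E. ennreal ((1/2) ^ n))"
    using assms emeasure_level by (intro sum.cong) auto
  finally show ?thesis by (simp add: ennreal_of_nat_eq_real_of_nat ennreal_mult)
qed

lemma emeasure_stage: "emeasure M (stage n) = ennreal (card (F n) * (1/2) ^ n)"
  unfolding stage_def by (rule emeasure_levels) auto

text \<open>Labels of the levels on which \<open>act g\<close> is a single translation. The unions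
  of these levels increase to \<open>carrier\<close>, which reduces measurability and invariance to
  finitely many translations per stage.\<close>

definition stable_labels :: "'g \<Rightarrow> nat \<Rightarrow> 'g set" where
  "stable_labels g n = {f \<in> F n. g + f \<in> F n}"

lemma UN_stable_labels_incseq: "incseq (\<lambda>n. \<Union>f\<in>stable_labels g n. level n f)"
proof (rule incseq_SucI, safe)
  fix n f x assume f: "f \<in> stable_labels g n" "x \<in> level n f"
  then have "x \<in> level (Suc n) f \<or> x \<in> level (Suc n) (f + c n)" "f \<in> stable_labels g (Suc n)"
    "f + c n \<in> stable_labels g (Suc n)"
    using level_split(1)[of f n] F_Suc[of f n] F_Suc[of "g + f" n] F_shift[of f n] F_shift[of "g + f" n]
    by (auto simp: stable_labels_def add.assoc)
  then show "x \<in> (\<Union>f\<in>stable_labels g (Suc n). level (Suc n) f)" by blast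
qed

lemma UN_stable_labels: "(\<Union>n. \<Union>f\<in>stable_labels g n. level n f) = carrier"
proof
  show "carrier \<subseteq> (\<Union>n. \<Union>f\<in>stable_labels g n. level n f)"
  proof
    fix x assume "x \<in> carrier"
    then obtain n f where "f \<in> F n" "x \<in> level n f" "g + f \<in> F n"
      using stage_eventually[of x g] by blast
    then show "x \<in> (\<Union>n. \<Union>f\<in>stable_labels g n. level n f)" by (auto simp: stable_labels_def)
  qed
qed (use level_carrier in \<open>auto simp: stable_labels_def\<close>)

lemma act_vimage_level:
  assumes "f \<in> stable_labels g n"
  shows "act g -` B \<inter> level n f = (\<lambda>x. x + (left_end n (g + f) - left_end n f)) -` (B \<inter> level n (g + f))"
proof -
  have "act g x = x + (left_end n (g + f) - left_end n f)" if "x \<in> level n f" for x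
    using assms act_eq[of f n x g] that by (simp add: stable_labels_def)
  moreover have "x + (left_end n (g + f) - left_end n f) \<in> level n (g + f) \<longleftrightarrow> x \<in> level n f" for x
    by (auto simp: level_def)
  ultimately show ?thesis by auto
qed

lemma act_vimage_borel:
  assumes [measurable]: "B \<in> sets borel"
  shows "act g -` B \<in> sets borel"
proof -
  have "act g -` B = (\<Union>n. \<Union>f\<in>stable_labels g n. act g -` B \<inter> level n f) \<union> (B - carrier)"
    using UN_stable_labels[of g] by (auto simp: act_def)
  also have "\<dots> \<in> sets borel"
  proof -
    have "act g -` B \<inter> level n f \<in> sets borel" if "f \<in> stable_labels g n" for n f
      using measurable_sets[of "\<lambda>x. x + (left_end n (g + f) - left_end n f)" borel borel "B \<inter> level n (g + f)"]
      by (simp add: act_vimage_level[OF that])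
    moreover have "finite (stable_labels g n)" for n using finite_F by (simp add: stable_labels_def)
    ultimately have "(\<Union>f\<in>stable_labels g n. act g -` B \<inter> level n f) \<in> sets borel" for n
      by (intro sets.finite_UN) auto
    then show ?thesis by (intro sets.Un sets.countable_UN) auto
  qed
  finally show ?thesis .
qed

lemma act_measurable [measurable]: "act g \<in> measurable M M"
  by (rule measurableI) (auto intro: act_vimage_borel)

text \<open>On each stable level the action is a translation, which preserves Lebesgue measure, and
  the target levels are again disjoint. The inequality suffices, since its use for
  \<open>- g\<close> gives the converse one.\<close>

lemma emeasure_act_vimage_le:
  assumes [measurable]: "B \<in> sets borel"
  shows "emeasure M (act g -` B) \<le> emeasure M B"
proof -
  let ?A = "\<lambda>n. act g -` B \<inter> (\<Union>f\<in>stable_labels g n. level n f)"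
  have fin: "finite (stable_labels g n)" for n using finite_F by (simp add: stable_labels_def)
  have [measurable]: "act g -` B \<in> sets borel" by (rule act_vimage_borel) simp
  have [measurable]: "(\<Union>f\<in>stable_labels g n. level n f) \<in> sets borel" for n
    using fin by (intro sets.finite_UN) auto
  have "emeasure M (act g -` B) = emeasure lborel (\<Union>n. ?A n)"
    using UN_stable_labels[of g] by (subst emeasure_M) (auto intro!: arg_cong[where f = "emeasure lborel"])
  also have "\<dots> = (SUP n. emeasure lborel (?A n))"
  proof (rule SUP_emeasure_incseq[symmetric])
    show "incseq ?A"
      using UN_stable_labels_incseq[of g] unfolding incseq_def by (meson Int_mono order_refl)
  qed auto
  also have "\<dots> \<le> emeasure M B"
  proof (rule SUP_least)
    fix n
    have dis: "disjoint_family_on (level n) (stable_labels g n)" "disjoint_family_on (\<lambda>f. level n (g + f)) (stable_labels g n)"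
      using level_disjoint by (fastforce simp: disjoint_family_on_def stable_labels_def)+
    have "emeasure lborel (?A n) = emeasure lborel (\<Union>f\<in>stable_labels g n. act g -` B \<inter> level n f)"
      by (rule arg_cong[where f = "emeasure lborel"]) auto
    also have "\<dots> = (\<Sum>f\<in>stable_labels g n. emeasure lborel (act g -` B \<inter> level n f))"
      using fin dis(1) by (intro sum_emeasure[symmetric]) (auto simp: disjoint_family_on_def)
    also have "\<dots> = (\<Sum>f\<in>stable_labels g n. emeasure lborel (B \<inter> level n (g + f)))"
    proof (rule sum.cong)
      fix f assume f: "f \<in> stable_labels g n"
      let ?t = "left_end n (g + f) - left_end n f"
      have "emeasure lborel (act g -` B \<inter> level n f) =
          emeasure (distr lborel borel ((+) ?t)) (B \<inter> level n (g + f))"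
        unfolding act_vimage_level[OF f] add.commute[of _ ?t] by (subst emeasure_distr) auto
      then show "emeasure lborel (act g -` B \<inter> level n f) = emeasure lborel (B \<inter> level n (g + f))"
        using lborel_distr_plus[of ?t] by simp
    qed simp
    also have "\<dots> = emeasure lborel (\<Union>f\<in>stable_labels g n. B \<inter> level n (g + f))"
      using fin dis(2) by (intro sum_emeasure) (auto simp: disjoint_family_on_def)
    also have "\<dots> \<le> emeasure lborel (carrier \<inter> B)"
      using level_carrier by (intro emeasure_mono) (auto simp: stable_labels_def)
    finally show "emeasure lborel (?A n) \<le> emeasure M B" by (simp add: emeasure_M)
  qed
  finally show ?thesis .
qed

lemma emeasure_act_vimage:
  assumes "B \<in> sets borel"
  shows "emeasure M (act g -` B) = emeasure M B"
proof (rule antisym)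
  show "emeasure M (act g -` B) \<le> emeasure M B" using assms by (rule emeasure_act_vimage_le)
  have "act (- g) -` act g -` B = B" by (auto simp: act_inverse)
  then show "emeasure M B \<le> emeasure M (act g -` B)"
    using emeasure_act_vimage_le[of "act g -` B" "- g"] act_vimage_borel[OF assms] by simp
qed

lemma distr_act: "distr M M (act g) = M"
  by (rule measure_eqI) (simp_all add: emeasure_distr emeasure_act_vimage)

lemma act_image: "act g ` B = act (- g) -` B"
  by (force simp: act_inverse image_iff)

lemma act_image_borel: "B \<in> sets borel \<Longrightarrow> act g ` B \<in> sets borel"
  by (simp add: act_image act_vimage_borel)

lemma emeasure_act_image: "B \<in> sets borel \<Longrightarrow> emeasure M (act g ` B) = emeasure M B"
  by (simp add: act_image emeasure_act_vimage)

lemma sigma_finite_M: "sigma_finite_measure M"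
  unfolding M_def
  using sigma_finite_measure.sigma_finite_iff_density_finite[OF sigma_finite_lborel, of "indicator carrier"]
  by (simp add: indicator_def)

section \<open>Descendants of a level\<close>

text \<open>Labels of the pieces of level \<open>f\<close> at stage \<open>n + k\<close>:
  \<open>f\<close> followed by a subproduct of \<open>c n\<close>, ..., \<open>c (n + k - 1)\<close>
  in this order.\<close>

fun offspring :: "nat \<Rightarrow> 'g \<Rightarrow> nat \<Rightarrow> 'g set" where
  "offspring n f 0 = {f}"
| "offspring n f (Suc k) = offspring n f k \<union> (\<lambda>h. h + c (n + k)) ` offspring n f k"

lemma offspring_F: "f \<in> F n \<Longrightarrow> offspring n f k \<subseteq> F (n + k)"
  by (induction k) (auto intro: F_Suc F_shift)

lemma level_offspring: "f \<in> F n \<Longrightarrow> level n f = (\<Union>h\<in>offspring n f k. level (n + k) h)"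
proof (induction k)
  case (Suc k)
  have "(\<Union>h\<in>offspring n f k. level (n + k) h) =
      (\<Union>h\<in>offspring n f k. level (Suc (n + k)) h \<union> level (Suc (n + k)) (h + c (n + k)))"
    using offspring_F[OF Suc.prems] by (intro SUP_cong refl level_split(1)) blast
  with Suc show ?case by auto
qed simp

lemma mem_offspring:
  assumes "f \<in> F n" "x \<in> level n f" "h \<in> F (n + k)" "x \<in> level (n + k) h"
  shows "h \<in> offspring n f k"
proof -
  obtain h' where h': "h' \<in> offspring n f k" "x \<in> level (n + k) h'"
    using assms(2) level_offspring[OF assms(1), of k] by blast
  then have "h = h'" using offspring_F[OF assms(1)] assms level_disjoint[of h "n + k" h'] by blast
  with h' show ?thesis by simp
qed

lemma level_subset_stage:
  assumes "n \<le> m" "h \<in> F m" "x \<in> level m h" "x \<in> stage n"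
  shows "level m h \<subseteq> stage n"
proof -
  obtain f where f: "f \<in> F n" "x \<in> level n f" using assms by (auto simp: stage_def)
  obtain k where k: "m = n + k" using assms le_Suc_ex by blast
  then have "h \<in> offspring n f k" using mem_offspring f assms by blast
  then show ?thesis using f(1) level_offspring[OF f(1), of k] k by (auto simp: stage_def)
qed

text \<open>At a late stage \<open>g\<close> moves the piece containing \<open>x\<close> to another
  piece of the same level. Returns thus become differences of descendants, a matter of the group
  alone.\<close>

lemma return_offspring:
  assumes "f \<in> F n" "x \<in> level n f" "act g x \<in> level n f"
  obtains k h h' where "h \<in> offspring n f k" "h' \<in> offspring n f k" "g = h' - h"
proof -
  have "x \<in> carrier" using assms level_carrier by blast
  then obtain N where N: "\<forall>n\<ge>N. \<exists>f\<in>F n. x \<in> level n f \<and> g + f \<in> F n"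
    using stage_eventually by blast
  obtain h where h: "h \<in> F (n + N)" "x \<in> level (n + N) h" "g + h \<in> F (n + N)"
    using N by (meson le_add2)
  have "h \<in> offspring n f N" "g + h \<in> offspring n f N"
    using mem_offspring[OF assms(1,2) h(1,2)] mem_offspring[OF assms(1,3) h(3) act_level_mem[OF h]] by auto
  then show ?thesis using that[of h N "g + h"] by simp
qed

section \<open>Approximation by unions of levels\<close>

definition tower :: "nat \<Rightarrow> 'g set \<Rightarrow> real set" where
  "tower n E = (\<Union>f\<in>E. level n f)"

lemma tower_borel [measurable]: "E \<subseteq> F n \<Longrightarrow> tower n E \<in> sets borel"
  unfolding tower_def using finite_subset[OF _ finite_F] by (intro sets.finite_UN) auto

lemma tower_mem: "E \<subseteq> F n \<Longrightarrow> f \<in> F n \<Longrightarrow> x \<in> level n f \<Longrightarrow> x \<in> tower n E \<longleftrightarrow> f \<in> E"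
  unfolding tower_def using level_disjoint by blast

text \<open>Asked at every late stage because the rank-one condition is a limit over all
  \<open>n\<close>; this also lets finitely many sets be approximated at a common stage.\<close>

definition approximable :: "real set \<Rightarrow> bool" where
  "approximable A \<longleftrightarrow> (\<forall>e>0. \<exists>N. \<forall>n\<ge>N. \<exists>E\<subseteq>F n. emeasure M (sym_diff A (tower n E)) \<le> ennreal e)"

text \<open>Every level of stage \<open>n\<close> lies on one side of \<open>a\<close>, except
  possibly the one containing \<open>a\<close>, which bounds the error by
  \<open>(1/2) ^ n\<close>.\<close>

lemma approximable_lessThan: "approximable ({..<a} \<inter> stage m)"
  unfolding approximable_def
proof (intro allI impI)
  fix e :: real assume "e > 0"
  then obtain k where k: "(1/2) ^ k < e" using real_arch_pow_inv[of e "1/2"] by auto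
  have "\<exists>E\<subseteq>F n. emeasure M (sym_diff ({..<a} \<inter> stage m) (tower n E)) \<le> ennreal e"
    if n: "n \<ge> max m k" for n
  proof (intro exI conjI)
    let ?E = "{f\<in>F n. level n f \<subseteq> stage m \<and> left_end n f < a}"
    show "?E \<subseteq> F n" by auto
    let ?A = "sym_diff ({..<a} \<inter> stage m) (tower n ?E)"
    have sub: "\<exists>f\<in>F n. a \<in> level n f \<and> x \<in> level n f" if "x \<in> ?A" for x
    proof -
      have "x \<in> stage m" using that by (auto simp: tower_def)
      then have "x \<in> stage n" using n incseqD[OF incseq_stage, of m n] by auto
      then obtain f where f: "f \<in> F n" "x \<in> level n f" by (auto simp: stage_def)
      have "level n f \<subseteq> stage m" using level_subset_stage[of m n f x] f n \<open>x \<in> stage m\<close> by auto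
      moreover have "f \<in> ?E \<longleftrightarrow> x \<notin> {..<a}"
        using that f tower_mem[of ?E n f x] \<open>x \<in> stage m\<close> by auto
      ultimately have "a \<in> level n f" using f by (auto simp: level_def)
      then show ?thesis using f by blast
    qed
    have "(1/2::real) ^ n \<le> (1/2) ^ k" using n by (intro power_decreasing) auto
    then have le: "(1/2::real) ^ n \<le> e" using k by linarith
    show "emeasure M ?A \<le> ennreal e"
    proof (cases "?A = {}")
      case True
      then show ?thesis by (simp only: emeasure_empty) simp
    next
      case False
      then obtain f where f: "f \<in> F n" "a \<in> level n f" using sub by blast
      then have "?A \<subseteq> level n f" using sub level_disjoint by blast
      then have "emeasure M ?A \<le> emeasure M (level n f)" by (rule emeasure_mono) auto
      also have "\<dots> \<le> ennreal e" using emeasure_level[OF f(1)] le by (simp add: ennreal_leI)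
      finally show ?thesis .
    qed
  qed
  then show "\<exists>N. \<forall>n\<ge>N. \<exists>E\<subseteq>F n. emeasure M (sym_diff ({..<a} \<inter> stage m) (tower n E)) \<le> ennreal e"
    by blast
qed

text \<open>The complementary labels are taken among the levels that make up \<open>stage m\<close>;
  the new error set is then contained in the old one.\<close>

lemma approximable_Compl:
  assumes "approximable (A \<inter> stage m)" and [measurable]: "A \<in> sets borel"
  shows "approximable ((UNIV - A) \<inter> stage m)"
  unfolding approximable_def
proof (intro allI impI)
  fix e :: real assume "e > 0"
  then obtain N where N: "\<forall>n\<ge>N. \<exists>E\<subseteq>F n. emeasure M (sym_diff (A \<inter> stage m) (tower n E)) \<le> ennreal e"
    using assms(1) by (auto simp: approximable_def)
  have "\<exists>E\<subseteq>F n. emeasure M (sym_diff ((UNIV - A) \<inter> stage m) (tower n E)) \<le> ennreal e"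
    if n: "n \<ge> max m N" for n
  proof -
    obtain E where E: "E \<subseteq> F n" "emeasure M (sym_diff (A \<inter> stage m) (tower n E)) \<le> ennreal e"
      using N n by auto
    let ?E = "{f\<in>F n. level n f \<subseteq> stage m} - E"
    have "sym_diff ((UNIV - A) \<inter> stage m) (tower n ?E) \<subseteq> sym_diff (A \<inter> stage m) (tower n E)"
    proof
      fix x assume x: "x \<in> sym_diff ((UNIV - A) \<inter> stage m) (tower n ?E)"
      then have "x \<in> stage m" by (auto simp: tower_def)
      then have "x \<in> stage n" using n incseqD[OF incseq_stage, of m n] by auto
      then obtain f where f: "f \<in> F n" "x \<in> level n f" by (auto simp: stage_def)
      have "level n f \<subseteq> stage m" using level_subset_stage[of m n f x] f n \<open>x \<in> stage m\<close> by auto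
      then show "x \<in> sym_diff (A \<inter> stage m) (tower n E)"
        using tower_mem[of ?E n f x] tower_mem[of E n f x] f E(1) x \<open>x \<in> stage m\<close> by auto
    qed
    then have "emeasure M (sym_diff ((UNIV - A) \<inter> stage m) (tower n ?E)) \<le>
        emeasure M (sym_diff (A \<inter> stage m) (tower n E))"
      using E(1) by (intro emeasure_mono) auto
    then show ?thesis using E(2) by (intro exI[of _ ?E]) auto
  qed
  then show "\<exists>N. \<forall>n\<ge>N. \<exists>E\<subseteq>F n. emeasure M (sym_diff ((UNIV - A) \<inter> stage m) (tower n E)) \<le> ennreal e"
    by blast
qed

lemma tail_small:
  assumes "decseq B" "\<And>i::nat. B i \<in> sets borel" "emeasure M (\<Inter>i. B i) = 0" "emeasure M (B 0) < \<infinity>" "e > 0"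
  shows "\<exists>k. emeasure M (B k) \<le> ennreal e"
proof -
  have fin: "emeasure M (B i) \<noteq> \<infinity>" for i
    using emeasure_mono[of "B i" "B 0" M] assms by (auto simp: decseq_def)
  have "(\<lambda>i. emeasure M (B i)) \<longlonglongrightarrow> emeasure M (\<Inter>i. B i)"
    using assms fin by (intro Lim_emeasure_decseq) auto
  then have "eventually (\<lambda>i. emeasure M (B i) < ennreal e) sequentially"
    using assms by (intro order_tendstoD(2)) auto
  then show ?thesis unfolding eventually_sequentially by (blast intro: less_imp_le)
qed

lemma emeasure_stage_finite: "emeasure M (A \<inter> stage m) < \<infinity>"
  using emeasure_mono[of "A \<inter> stage m" "stage m" M] emeasure_stage[of m]
  by (auto simp: less_top intro: le_less_trans)

text \<open>Since \<open>stage m\<close> has finite measure, the union may be cut off after finitely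
  many sets at a cost of \<open>e/2\<close>; the other half is shared among these sets.\<close>

lemma approximable_UN:
  fixes A :: "nat \<Rightarrow> real set"
  assumes "\<And>i. approximable (A i \<inter> stage m)" and [measurable]: "\<And>i. A i \<in> sets borel"
  shows "approximable ((\<Union>i. A i) \<inter> stage m)"
  unfolding approximable_def
proof (intro allI impI)
  fix e :: real assume e: "e > 0"
  let ?A = "(\<Union>i. A i) \<inter> stage m"
  let ?B = "\<lambda>k. ?A - (\<Union>i<k. A i)"
  have "\<exists>k. emeasure M (?B k) \<le> ennreal (e/2)"
  proof (rule tail_small)
    show "decseq ?B" by (auto simp: decseq_def)
    have "x \<notin> (\<Inter>i. ?B i)" for x
    proof
      assume x: "x \<in> (\<Inter>i. ?B i)"
      then obtain i where "x \<in> A i" by blast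
      moreover have "x \<in> ?B (Suc i)" using x by blast
      ultimately show False by auto
    qed
    then have "(\<Inter>i. ?B i) = {}" by blast
    then show "emeasure M (\<Inter>i. ?B i) = 0" by (simp only: emeasure_empty)
    show "emeasure M (?B 0) < \<infinity>" using emeasure_stage_finite by simp
  qed (use e in auto)
  then obtain k where k: "emeasure M (?B k) \<le> ennreal (e/2)" by blast
  \<comment> \<open>The summand 1 keeps the denominator nonzero when \<open>k = 0\<close>.\<close>
  define e' where "e' = e / (2 * (real k + 1))"
  have e': "e' > 0" "real k * e' \<le> e / 2" using e by (auto simp: e'_def field_simps)
  have "\<forall>i. \<exists>N. \<forall>n\<ge>N. \<exists>E\<subseteq>F n. emeasure M (sym_diff (A i \<inter> stage m) (tower n E)) \<le> ennreal e'"
    using assms(1) e' by (auto simp: approximable_def)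
  then obtain N where N: "\<And>i n. n \<ge> N i \<Longrightarrow> \<exists>E\<subseteq>F n. emeasure M (sym_diff (A i \<inter> stage m) (tower n E)) \<le> ennreal e'"
    by metis
  have "\<exists>E\<subseteq>F n. emeasure M (sym_diff ?A (tower n E)) \<le> ennreal e" if n: "n \<ge> Max (N ` {..k})" for n
  proof -
    have "n \<ge> N i" if "i < k" for i using n that by (intro order_trans[OF Max_ge n]) auto
    then have "\<forall>i. \<exists>E. i < k \<longrightarrow> E \<subseteq> F n \<and> emeasure M (sym_diff (A i \<inter> stage m) (tower n E)) \<le> ennreal e'"
      using N by blast
    from choice[OF this] obtain E where E: "\<And>i. i < k \<Longrightarrow> E i \<subseteq> F n"
      "\<And>i. i < k \<Longrightarrow> emeasure M (sym_diff (A i \<inter> stage m) (tower n (E i))) \<le> ennreal e'"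
      by blast
    let ?E = "\<Union>i<k. E i"
    define C where "C i = sym_diff (A i \<inter> stage m) (tower n (E i))" for i
    have C: "C i \<in> sets M" if "i < k" for i using E(1)[OF that] by (auto simp: C_def)
    have "sym_diff ?A (tower n ?E) \<subseteq> ?B k \<union> (\<Union>i<k. C i)"
      by (auto simp: tower_def C_def)
    then have "emeasure M (sym_diff ?A (tower n ?E)) \<le> emeasure M (?B k \<union> (\<Union>i<k. C i))"
      using C by (intro emeasure_mono sets.Un sets.finite_UN) auto
    also have "\<dots> \<le> emeasure M (?B k) + emeasure M (\<Union>i<k. C i)"
      using C by (intro emeasure_subadditive sets.finite_UN) auto
    also have "emeasure M (\<Union>i<k. C i) \<le> (\<Sum>i<k. emeasure M (C i))"
      using C by (intro emeasure_subadditive_finite) auto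
    also have "\<dots> \<le> (\<Sum>i<k. ennreal e')" using E(2) by (intro sum_mono) (auto simp: C_def)
    also have "\<dots> = ennreal (real k * e')" using e' by (simp add: ennreal_of_nat_eq_real_of_nat ennreal_mult)
    also have "\<dots> \<le> ennreal (e/2)" using e' by (simp add: ennreal_leI)
    also have "emeasure M (?B k) + ennreal (e/2) \<le> ennreal (e/2) + ennreal (e/2)" using k by (rule add_right_mono)
    also have "\<dots> = ennreal e" using e by (simp flip: ennreal_plus)
    finally have "emeasure M (sym_diff ?A (tower n ?E)) \<le> ennreal e" by (simp add: add_left_mono)
    then show ?thesis using E(1) by (intro exI[of _ ?E]) auto
  qed
  then show "\<exists>N. \<forall>n\<ge>N. \<exists>E\<subseteq>F n. emeasure M (sym_diff ?A (tower n E)) \<le> ennreal e" by blast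
qed

text \<open>Half-lines generate the Borel sets, and the three preceding closure facts drive the
  induction. Staying inside one stage keeps all measures finite.\<close>

lemma approximable_Int_stage:
  assumes "A \<in> sets borel"
  shows "approximable (A \<inter> stage m)"
proof -
  have borel: "sets (borel::real measure) = sigma_sets UNIV (range lessThan)"
    by (subst borel_Iio) (simp add: sets_measure_of)
  from assms have "A \<in> sigma_sets UNIV (range lessThan)" by (simp add: borel)
  then show ?thesis
  proof induction
    case (Basic a)
    then show ?case using approximable_lessThan by auto
  next
    case Empty
    show ?case by (auto simp: approximable_def tower_def intro!: exI[of _ "{}"])
  next
    case (Compl a)
    then show ?case using approximable_Compl borel by auto
  next
    case (Union a)
    then show ?case using approximable_UN borel by auto
  qed
qed

text \<open>The stages exhaust \<open>carrier\<close>, off which the measure vanishes, so a set of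
  finite measure loses little when cut down to a late stage.\<close>

lemma approximable_finite:
  assumes [measurable]: "A \<in> sets borel" and "emeasure M A < \<infinity>"
  shows "approximable A"
  unfolding approximable_def
proof (intro allI impI)
  fix e :: real assume e: "e > 0"
  have "\<exists>k. emeasure M (A - stage k) \<le> ennreal (e/2)"
  proof (rule tail_small)
    show "decseq (\<lambda>k. A - stage k)" using incseq_stage by (auto simp: decseq_def incseq_def)
    have "(\<Inter>i. A - stage i) = A - carrier" by (auto simp: carrier_def)
    then show "emeasure M (\<Inter>i. A - stage i) = 0" by (simp add: emeasure_M)
    show "emeasure M (A - stage 0) < \<infinity>"
      using emeasure_mono[of "A - stage 0" A M] assms(2) by (auto intro: le_less_trans)
  qed (use e in auto)
  then obtain m where m: "emeasure M (A - stage m) \<le> ennreal (e/2)" by blast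
  obtain N where N: "\<And>n. n \<ge> N \<Longrightarrow> \<exists>E\<subseteq>F n. emeasure M (sym_diff (A \<inter> stage m) (tower n E)) \<le> ennreal (e/2)"
    using approximable_Int_stage[OF assms(1), of m] e unfolding approximable_def by (metis half_gt_zero)
  have "\<exists>E\<subseteq>F n. emeasure M (sym_diff A (tower n E)) \<le> ennreal e" if n: "n \<ge> N" for n
  proof -
    obtain E where E: "E \<subseteq> F n" "emeasure M (sym_diff (A \<inter> stage m) (tower n E)) \<le> ennreal (e/2)"
      using N[OF n] by blast
    have "emeasure M (sym_diff A (tower n E)) \<le> emeasure M ((A - stage m) \<union> sym_diff (A \<inter> stage m) (tower n E))"
      using E(1) by (intro emeasure_mono) auto
    also have "\<dots> \<le> emeasure M (A - stage m) + emeasure M (sym_diff (A \<inter> stage m) (tower n E))"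
      using E(1) by (intro emeasure_subadditive) auto
    also have "\<dots> \<le> ennreal (e/2) + ennreal (e/2)" using m E(2) by (rule add_mono)
    also have "\<dots> = ennreal e" using e by (simp flip: ennreal_plus)
    finally show ?thesis using E(1) by blast
  qed
  then show "\<exists>N. \<forall>n\<ge>N. \<exists>E\<subseteq>F n. emeasure M (sym_diff A (tower n E)) \<le> ennreal e" by blast
qed

lemma approximation_tendsto:
  assumes "A \<in> sets borel" "emeasure M A < \<infinity>"
  shows "(\<lambda>n. Min ((\<lambda>E. emeasure M (sym_diff A (tower n E))) ` Pow (F n))) \<longlonglongrightarrow> 0"
    (is "?m \<longlonglongrightarrow> 0")
proof (rule order_tendstoI)
  fix a :: ennreal assume "0 < a"
  then obtain e where e: "0 < e" "ennreal e < a"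
    by (metis ennreal_less_zero_iff ennreal_cases dense order.strict_trans top.not_eq_extremum)
  obtain N where N: "\<And>n. n \<ge> N \<Longrightarrow> \<exists>E\<subseteq>F n. emeasure M (sym_diff A (tower n E)) \<le> ennreal e"
    using approximable_finite[OF assms] e(1) unfolding approximable_def by metis
  have "?m n < a" if n: "n \<ge> N" for n
  proof -
    obtain E where "E \<subseteq> F n" "emeasure M (sym_diff A (tower n E)) \<le> ennreal e" using N n by blast
    then have "?m n \<le> ennreal e"
      using finite_F by (intro order_trans[OF Min_le[of _ "emeasure M (sym_diff A (tower n E))"]]) auto
    then show ?thesis using e(2) by simp
  qed
  then show "eventually (\<lambda>n. ?m n < a) sequentially" by (auto simp: eventually_sequentially)
qed simp

section \<open>Dense levels and returns\<close>

lemma fmeasurable_level: "f \<in> F n \<Longrightarrow> level n f \<in> fmeasurable M"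
  by (intro fmeasurableI) (auto simp: emeasure_level)

lemma measure_level: "f \<in> F n \<Longrightarrow> measure M (level n f) = (1/2) ^ n"
  by (simp add: measure_def emeasure_level)

text \<open>A substitute for the Lebesgue density theorem: some part of \<open>A\<close> of positive
  measure in one stage is well approximated by a tower, whose levels cannot all be filled to at most
  three quarters.\<close>

lemma ex_dense_level:
  assumes [measurable]: "A \<in> sets borel" and "emeasure M A > 0"
  obtains n f where "f \<in> F n" "measure M (A \<inter> level n f) > 3/4 * (1/2) ^ n"
proof -
  have "\<exists>m. emeasure M (A \<inter> stage m) \<noteq> 0"
  proof (rule ccontr)
    assume "\<nexists>m. emeasure M (A \<inter> stage m) \<noteq> 0"
    then have "(\<Union>m. A \<inter> stage m) \<in> null_sets M" by (intro null_sets_UN) (auto intro!: null_setsI)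
    moreover have "(\<Union>m. A \<inter> stage m) = carrier \<inter> A" by (auto simp: carrier_def)
    ultimately have "emeasure M (carrier \<inter> A) = 0" by auto
    then show False using assms(2) by (simp add: emeasure_M Int_assoc[symmetric])
  qed
  then obtain m where m: "emeasure M (A \<inter> stage m) \<noteq> 0" by blast
  define B where "B = A \<inter> stage m"
  define b where "b = measure M B"
  have [measurable]: "B \<in> sets borel" by (simp add: B_def)
  have Bfin: "emeasure M B \<noteq> \<infinity>" using emeasure_stage_finite[of A m] by (simp add: B_def)
  have emB: "emeasure M B = ennreal b" using Bfin by (simp add: b_def emeasure_eq_ennreal_measure)
  have b: "b > 0" using m emB by (auto simp: B_def[symmetric] ennreal_eq_0_iff not_le)
  \<comment> \<open>The tower then has measure at most \<open>11/10 * b\<close>; if \<open>A\<close>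
    filled at most 3/4 of each level, the measure of \<open>B\<close> would be at most
    \<open>(1/10 + 3/4 * 11/10) * b\<close>, which is less than \<open>b\<close>.\<close>
  define e where "e = b / 10"
  have e: "e > 0" using b by (simp add: e_def)
  obtain n where "\<exists>E\<subseteq>F n. emeasure M (sym_diff B (tower n E)) \<le> ennreal e"
    using approximable_Int_stage[of A m] e unfolding approximable_def B_def by (meson assms(1) order_refl)
  then obtain E where E: "E \<subseteq> F n" "emeasure M (sym_diff B (tower n E)) \<le> ennreal e" by blast
  let ?s = "card E * (1/2::real) ^ n"
  have finE: "finite E" using E(1) finite_F finite_subset by blast
  have s: "emeasure M (tower n E) = ennreal ?s" using emeasure_levels[OF E(1)] by (simp add: tower_def)
  have [measurable]: "tower n E \<in> sets borel" using E(1) by simp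
  have "ennreal ?s \<le> emeasure M (B \<union> sym_diff B (tower n E))"
    unfolding s[symmetric] by (intro emeasure_mono) auto
  also have "\<dots> \<le> emeasure M B + emeasure M (sym_diff B (tower n E))"
    by (intro emeasure_subadditive) auto
  also have "\<dots> \<le> ennreal b + ennreal e" using emB E(2) by (intro add_mono) auto
  also have "\<dots> = ennreal (b + e)" using b e by simp
  finally have s_le: "?s \<le> b + e" using b e by (subst (asm) ennreal_le_iff) auto
  have "\<exists>f\<in>E. measure M (A \<inter> level n f) > 3/4 * (1/2) ^ n"
  proof (rule ccontr)
    assume "\<not> ?thesis"
    then have small: "measure M (A \<inter> level n f) \<le> 3/4 * (1/2) ^ n" if "f \<in> E" for f
      using that by (auto simp: not_less)
    have le: "emeasure M (B \<inter> level n f) \<le> ennreal (3/4 * (1/2) ^ n)" if f: "f \<in> E" for f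
    proof -
      have "A \<inter> level n f \<in> fmeasurable M"
        using f E(1) by (intro fmeasurableI2[OF fmeasurable_level[of f n]]) auto
      then have "emeasure M (A \<inter> level n f) \<le> ennreal (3/4 * (1/2) ^ n)"
        by (subst emeasure_eq_measure2) (use small[OF f] in \<open>auto intro: ennreal_leI\<close>)
      moreover have "emeasure M (B \<inter> level n f) \<le> emeasure M (A \<inter> level n f)"
        by (intro emeasure_mono) (auto simp: B_def)
      ultimately show ?thesis by simp
    qed
    have "ennreal b \<le> emeasure M (sym_diff B (tower n E) \<union> (\<Union>f\<in>E. B \<inter> level n f))"
      unfolding emB[symmetric] using finE by (intro emeasure_mono sets.Un sets.finite_UN) (auto simp: tower_def)
    also have "\<dots> \<le> emeasure M (sym_diff B (tower n E)) + emeasure M (\<Union>f\<in>E. B \<inter> level n f)"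
      using finE by (intro emeasure_subadditive sets.finite_UN) auto
    also have "\<dots> \<le> ennreal e + (\<Sum>f\<in>E. emeasure M (B \<inter> level n f))"
      using E(2) finE by (intro add_mono emeasure_subadditive_finite) auto
    also have "\<dots> \<le> ennreal e + (\<Sum>f\<in>E. ennreal (3/4 * (1/2) ^ n))"
      using le by (intro add_left_mono sum_mono) auto
    also have "\<dots> = ennreal e + ennreal (3/4 * ?s)"
      by (simp add: ennreal_of_nat_eq_real_of_nat ennreal_mult[symmetric] mult_ac)
    also have "\<dots> = ennreal (e + 3/4 * ?s)" using e by simp
    finally have "b \<le> e + 3/4 * ?s" using e by (subst (asm) ennreal_le_iff) auto
    then show False using s_le b by (simp add: e_def)
  qed
  then show ?thesis using that E(1) by blast
qed

text \<open>At least one half of a level is as dense as the whole.\<close>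

lemma dense_offspring:
  assumes "f \<in> F n" and A [measurable]: "A \<in> sets borel" and "measure M (A \<inter> level n f) > 3/4 * (1/2) ^ n"
  shows "\<exists>h\<in>offspring n f k. measure M (A \<inter> level (n + k) h) > 3/4 * (1/2) ^ (n + k)"
proof (induction k)
  case (Suc k)
  then obtain h where h: "h \<in> offspring n f k" "measure M (A \<inter> level (n + k) h) > 3/4 * (1/2) ^ (n + k)"
    by blast
  have hF: "h \<in> F (n + k)" using h offspring_F[OF assms(1)] by blast
  let ?L = "level (Suc (n + k)) h" and ?R = "level (Suc (n + k)) (h + c (n + k))"
  have "measure M (A \<inter> level (n + k) h) = measure M ((A \<inter> ?L) \<union> (A \<inter> ?R))"
    unfolding level_split(1)[OF hF] by (simp add: Int_Un_distrib)
  also have "\<dots> \<le> measure M (A \<inter> ?L) + measure M (A \<inter> ?R)" by (intro measure_Un_le) auto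
  finally have "measure M (A \<inter> ?L) > 3/4 * (1/2) ^ Suc (n + k) \<or> measure M (A \<inter> ?R) > 3/4 * (1/2) ^ Suc (n + k)"
    using h(2) by auto
  then show ?case using h(1) by auto
qed (use assms in simp)

text \<open>Density above 3/4 in a level forces density above 1/2 in each half. The element
  \<open>f + c n - f\<close> carries the left half onto the right one, where two sets of density
  above 1/2 overlap in positive measure.\<close>

lemma dense_level_returns:
  assumes f: "f \<in> F n" and A [measurable]: "A \<in> sets borel"
    and dense: "measure M (A \<inter> level n f) > 3/4 * (1/2) ^ n"
  shows "0 < emeasure M (A \<inter> act (f + c n - f) ` A)"
proof (rule ccontr)
  let ?g = "f + c n - f" and ?L = "level (Suc n) f" and ?R = "level (Suc n) (f + c n)"
  assume "\<not> ?thesis"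
  have [measurable]: "act ?g ` B \<in> sets borel" if "B \<in> sets borel" for B using that by (rule act_image_borel)
  from \<open>\<not> ?thesis\<close> have null: "A \<inter> act ?g ` A \<in> null_sets M"
    by (intro null_setsI) auto
  then have null': "A \<inter> act ?g ` A \<in> fmeasurable M" by (intro fmeasurableI) auto
  have F: "f \<in> F (Suc n)" "f + c n \<in> F (Suc n)" using f F_Suc F_shift by auto
  have gf: "?g + f = f + c n" by (simp add: add.assoc[symmetric])
  have split: "measure M (A \<inter> level n f) \<le> measure M (A \<inter> ?L) + measure M (A \<inter> ?R)"
    unfolding level_split(1)[OF f] Int_Un_distrib by (intro measure_Un_le) auto
  have le: "measure M (A \<inter> level (Suc n) h) \<le> (1/2) ^ Suc n" if "h \<in> F (Suc n)" for h
    unfolding measure_level[OF that, symmetric] using that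
    by (intro measure_mono_fmeasurable fmeasurable_level) auto
  then have L: "measure M (A \<inter> ?L) > (1/2) ^ Suc n / 2" and R: "measure M (A \<inter> ?R) > (1/2) ^ Suc n / 2"
    using split dense le[OF F(1)] le[OF F(2)] unfolding power_Suc by linarith+
  have "act ?g ` (A \<inter> ?L) \<subseteq> ?R" using act_level[of f "Suc n" ?g] F gf by auto
  then have sub: "act ?g ` (A \<inter> ?L) \<subseteq> (?R - A) \<union> (A \<inter> act ?g ` A)" by auto
  have Rfin: "?R \<in> fmeasurable M" using F fmeasurable_level by blast
  have "measure M (A \<inter> ?L) = measure M (act ?g ` (A \<inter> ?L))"
    by (simp add: measure_def emeasure_act_image)
  also have "\<dots> \<le> measure M ((?R - A) \<union> (A \<inter> act ?g ` A))"
    using sub Rfin null' by (intro measure_mono_fmeasurable fmeasurable.Un fmeasurable_Diff) auto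
  also have "\<dots> = measure M (?R - A)" using null by (intro measure_Un_null_set) auto
  also have "\<dots> = measure M (?R - (A \<inter> ?R))" by (rule arg_cong[where f = "measure M"]) auto
  also have "\<dots> = measure M ?R - measure M (A \<inter> ?R)"
    using Rfin by (intro measurable_measure_Diff) auto
  finally show False using L R measure_level[OF F(2)] by simp
qed

text \<open>The level \<open>f\<close> is fixed first and \<open>k\<close> is arbitrary afterwards,
  so the direction of \<open>c (n + k)\<close> can be chosen in view of \<open>f\<close>.\<close>

lemma returns_of_offspring:
  assumes "A \<in> sets borel" "emeasure M A > 0"
  obtains n f where "f \<in> F n"
    "\<And>k. \<exists>h\<in>offspring n f k. 0 < emeasure M (A \<inter> act (h + c (n + k) - h) ` A)"
proof -
  obtain n f where nf: "f \<in> F n" "measure M (A \<inter> level n f) > 3/4 * (1/2) ^ n"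
    using ex_dense_level assms by blast
  have "\<exists>h\<in>offspring n f k. 0 < emeasure M (A \<inter> act (h + c (n + k) - h) ` A)" for k
    using dense_offspring[OF nf(1) assms(1) nf(2), of k] dense_level_returns[OF _ assms(1)]
      offspring_F[OF nf(1), of k] by blast
  then show ?thesis using that nf(1) by blast
qed

lemma infinite_M:
  assumes "\<And>r. \<exists>n. r \<le> card (F n) * (1/2::real) ^ n"
  shows "emeasure M UNIV = \<infinity>"
proof (rule ccontr)
  assume "emeasure M UNIV \<noteq> \<infinity>"
  then obtain r where r: "r \<ge> 0" "emeasure M UNIV = ennreal r" by (cases "emeasure M UNIV") auto
  obtain n where n: "r + 1 \<le> card (F n) * (1/2::real) ^ n" using assms by blast
  have "emeasure M (stage n) \<le> emeasure M UNIV" by (intro emeasure_mono) auto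
  then have "card (F n) * (1/2::real) ^ n \<le> r" using r by (simp add: emeasure_stage)
  with n show False by simp
qed

end

section \<open>The integer Heisenberg group\<close>

text \<open>The integer matrix with entries \<open>x\<close> at (1,2), \<open>z\<close> at (2,3) and
  \<open>y\<close> at (1,3). The product is written additively because \<open>group_add\<close> is
  the class of possibly noncommutative groups.\<close>

datatype heis = Heis (hx: int) (hz: int) (hy: int)

instance heis :: countable
  by countable_datatype

instantiation heis :: group_add
begin

definition "0 = Heis 0 0 0"
definition "g + h = Heis (hx g + hx h) (hz g + hz h) (hy g + hy h + hx g * hz h)"
definition "- g = Heis (- hx g) (- hz g) (- hy g + hx g * hz g)"
definition "g - h = g + - (h :: heis)"

instance
  by standard (auto simp: zero_heis_def plus_heis_def uminus_heis_def minus_heis_def algebra_simps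
      intro: heis.expand)

end

lemma heis_sel [simp]:
  "hx 0 = 0" "hz 0 = 0" "hy 0 = 0"
  "hx (g + h) = hx g + hx h" "hz (g + h) = hz g + hz h" "hy (g + h) = hy g + hy h + hx g * hz h"
  "hx (- g) = - hx g" "hz (- g) = - hz g" "hy (- g) = - hy g + hx g * hz g"
  "hx (g - h) = hx g - hx h" "hz (g - h) = hz g - hz h"
  "hy (g - h) = hy g - hy h + hx h * hz h - hx g * hz h"
  by (simp_all add: zero_heis_def plus_heis_def uminus_heis_def minus_heis_def)

section \<open>Boxes, growth rates and shifts\<close>

definition box :: "int \<Rightarrow> int \<Rightarrow> int \<Rightarrow> heis set" where
  "box P Q R = {g. \<bar>hx g\<bar> \<le> P \<and> \<bar>hz g\<bar> \<le> Q \<and> \<bar>hy g\<bar> \<le> R}"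

lemma box_eq: "box P Q R = (\<lambda>(x, z, y). Heis x z y) ` ({-P..P} \<times> {-Q..Q} \<times> {-R..R})"
proof
  show "box P Q R \<subseteq> (\<lambda>(x, z, y). Heis x z y) ` ({-P..P} \<times> {-Q..Q} \<times> {-R..R})"
  proof
    fix g assume "g \<in> box P Q R"
    then show "g \<in> (\<lambda>(x, z, y). Heis x z y) ` ({-P..P} \<times> {-Q..Q} \<times> {-R..R})"
      by (intro image_eqI[of _ _ "(hx g, hz g, hy g)"]) (auto simp: box_def)
  qed
qed (auto simp: box_def)

lemma finite_box [simp]: "finite (box P Q R)"
  by (simp add: box_eq)

lemma card_box:
  assumes "P \<ge> 0" "Q \<ge> 0" "R \<ge> 0"
  shows "real (card (box P Q R)) =
    (2 * real_of_int P + 1) * (2 * real_of_int Q + 1) * (2 * real_of_int R + 1)"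
proof -
  have "card (box P Q R) = card ({-P..P} \<times> {-Q..Q} \<times> {-R..R})"
    unfolding box_eq by (intro card_image) (auto simp: inj_on_def)
  then show ?thesis using assms by (simp add: card_cartesian_product)
qed

text \<open>The cubic factor leaves room in the next box for a shift of slope up to
  \<open>n\<close>. The lower bounds \<open>4 ^ n\<close> and \<open>int n ^ 3\<close> serve the
  infinite measure and the Folner estimate.\<close>

primrec width :: "nat \<Rightarrow> int" where
  "width 0 = 1"
| width_Suc: "width (Suc n) = (int n + 3) ^ 3 * width n"

lemma width_ge_1: "width n \<ge> 1"
proof (induction n)
  case (Suc n)
  have "1 \<le> (int n + 3) ^ 3" by (intro one_le_power) auto
  with Suc have "1 * 1 \<le> (int n + 3) ^ 3 * width n" by (intro mult_mono) auto
  then show ?case by simp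
qed simp

lemma width_ge_4_power: "width n \<ge> 4 ^ n"
proof (induction n)
  case (Suc n)
  have "(4::int) \<le> 3 ^ 3" by simp
  also have "\<dots> \<le> (int n + 3) ^ 3" by (intro power_mono) auto
  finally have "4 * 4 ^ n \<le> (int n + 3) ^ 3 * width n" using Suc by (intro mult_mono) auto
  then show ?case by simp
qed simp

lemma width_ge_cube: "width n \<ge> int n ^ 3"
proof (cases n)
  case (Suc m)
  have "int n ^ 3 * 1 \<le> (int m + 3) ^ 3 * width m"
    using width_ge_1[of m] Suc by (intro mult_mono power_mono) auto
  then show ?thesis by (simp add: Suc)
qed simp

text \<open>Large enough for a shift to leave the box; the unbounded ratio to \<open>width n\<close>
  makes errors of order \<open>width n\<close> negligible.\<close>

definition gap :: "nat \<Rightarrow> int" where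
  "gap n = (int n + 3) * width n"

text \<open>The summands bound an entry of the old box, the \<open>hy\<close>-entry of the shift,
  the mixed product \<open>hx g * hz f\<close>, and an entry of a translating \<open>g\<close> of
  size at most \<open>n\<close>.\<close>

lemma width_Suc_ge: "width n + (int n + 1) * gap n + int n ^ 3 + int n \<le> width (Suc n)"
proof -
  have "width n + (int n + 1) * gap n + int n ^ 3 + int n \<le>
      width n + (int n + 1) * gap n + (int n ^ 3 + int n) * width n"
    using mult_left_mono[OF width_ge_1[of n], of "int n ^ 3 + int n"] by simp
  also have "\<dots> = (int n ^ 3 + int n ^ 2 + 5 * int n + 4) * width n"
    by (simp add: gap_def algebra_simps power2_eq_square power3_eq_cube)
  also have "\<dots> \<le> (int n + 3) ^ 3 * width n"
    using width_ge_1[of n] by (intro mult_right_mono) (auto simp: algebra_simps power2_eq_square power3_eq_cube)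
  finally show ?thesis by simp
qed

text \<open>Shifts have zero \<open>hz\<close>-entry, so the \<open>hz\<close>-range only has to
  absorb translations. Its quadratic growth makes the mixed product \<open>hx g * hz f\<close>
  negligible against the \<open>hy\<close>-range.\<close>

definition height :: "nat \<Rightarrow> heis set" where
  "height n = box (width n) (int n ^ 2) (width n)"

text \<open>Decoding \<open>n\<close> makes every slope \<open>l\<close>, and the central direction, occur for infinitely many \<open>n\<close>.\<close>

definition shift :: "nat \<Rightarrow> heis" where
  "shift n =
     (case from_nat (fst (prod_decode n)) of
        Some l \<Rightarrow> if \<bar>l\<bar> \<le> int n then Heis (gap n) 0 (l * gap n) else Heis 0 0 (gap n)
      | None \<Rightarrow> Heis 0 0 (gap n))"

lemma shift_cases:
  obtains l where "\<bar>l\<bar> \<le> int n" "shift n = Heis (gap n) 0 (l * gap n)" | "shift n = Heis 0 0 (gap n)"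
proof (cases "from_nat (fst (prod_decode n)) :: int option")
  case None
  then show ?thesis using that(2) by (simp add: shift_def)
next
  case (Some l)
  then show ?thesis using that(1)[of l] that(2) by (cases "\<bar>l\<bar> \<le> int n") (simp_all add: shift_def)
qed

lemma shift_slope: "\<exists>k. shift (n + k) = Heis (gap (n + k)) 0 (l * gap (n + k))"
proof -
  \<comment> \<open>Adding \<open>nat \<bar>l\<bar>\<close> makes the stage at least
    \<open>\<bar>l\<bar>\<close>, so that the test in \<open>shift\<close> accepts this
    slope.\<close>
  let ?j = "n + nat \<bar>l\<bar>"
  let ?m = "prod_encode (to_nat (Some l), ?j)"
  have "?j \<le> ?m" by (rule le_prod_encode_2)
  then obtain k where "?m = n + k" "\<bar>l\<bar> \<le> int ?m" by (metis add_leD1 le_Suc_ex le_nat_iff abs_ge_zero add_leD2 nat_le_iff)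
  then show ?thesis by (intro exI[of _ k]) (simp add: shift_def flip: \<open>?m = n + k\<close>)
qed

lemma shift_central: "\<exists>k. shift (n + k) = Heis 0 0 (gap (n + k))"
proof -
  let ?m = "prod_encode (to_nat (None :: int option), n)"
  obtain k where "?m = n + k" using le_prod_encode_2 le_Suc_ex by blast
  then show ?thesis by (intro exI[of _ k]) (simp add: shift_def flip: \<open>?m = n + k\<close>)
qed

lemma gap_ge: "gap n \<ge> 3 * width n" "gap n > 0"
  using width_ge_1[of n] unfolding gap_def by (auto intro!: mult_right_mono)

lemma hz_shift [simp]: "hz (shift n) = 0"
  by (cases n rule: shift_cases) auto

lemma shift_bounds: "\<bar>hx (shift n)\<bar> \<le> gap n" "\<bar>hy (shift n)\<bar> \<le> (int n + 1) * gap n"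
  "\<bar>hx (shift n)\<bar> = gap n \<or> \<bar>hy (shift n)\<bar> = gap n"
proof -
  have "\<bar>l\<bar> * gap n \<le> (int n + 1) * gap n" if "\<bar>l\<bar> \<le> int n" for l
    using that gap_ge(2)[of n] by (intro mult_right_mono) auto
  moreover have "1 * gap n \<le> (int n + 1) * gap n" using gap_ge(2)[of n] by (intro mult_right_mono) auto
  ultimately show "\<bar>hx (shift n)\<bar> \<le> gap n" "\<bar>hy (shift n)\<bar> \<le> (int n + 1) * gap n"
    "\<bar>hx (shift n)\<bar> = gap n \<or> \<bar>hy (shift n)\<bar> = gap n"
    using gap_ge(2)[of n] by (cases n rule: shift_cases; auto simp: abs_mult)+
qed

text \<open>As \<open>hz (shift n) = 0\<close>, the right factor contributes no mixed product. The
  only nonlinear term is \<open>hx g * hz f\<close>, of size at most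
  \<open>int n ^ 3\<close>.\<close>

lemma height_Suc_translate:
  assumes "f \<in> height n" "\<bar>hx g\<bar> \<le> int n" "\<bar>hz g\<bar> \<le> int n" "\<bar>hy g\<bar> \<le> int n"
  shows "g + f \<in> height (Suc n)" "g + f + shift n \<in> height (Suc n)"
proof -
  have f: "\<bar>hx f\<bar> \<le> width n" "\<bar>hz f\<bar> \<le> int n ^ 2" "\<bar>hy f\<bar> \<le> width n"
    using assms by (auto simp: height_def box_def)
  have "\<bar>hx g * hz f\<bar> \<le> int n * int n ^ 2"
    unfolding abs_mult using f assms by (intro mult_mono) auto
  then have gf: "\<bar>hx g * hz f\<bar> \<le> int n ^ 3" by (simp add: power3_eq_cube power2_eq_square)
  have "1 * gap n \<le> (int n + 1) * gap n" using gap_ge(2)[of n] by (intro mult_right_mono) auto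
  moreover have "int n ^ 3 \<ge> 0" "0 \<le> (int n + 1) * gap n" using gap_ge(2)[of n] by auto
  moreover have "int n + int n ^ 2 \<le> int (Suc n) ^ 2" by (simp add: power2_eq_square algebra_simps)
  ultimately have "\<bar>hx g + hx f\<bar> \<le> width (Suc n)" "\<bar>hx g + hx f + hx (shift n)\<bar> \<le> width (Suc n)"
    "\<bar>hz g + hz f\<bar> \<le> int (Suc n) ^ 2" "\<bar>hy g + hy f + hx g * hz f\<bar> \<le> width (Suc n)"
    "\<bar>hy g + hy f + hx g * hz f + hy (shift n)\<bar> \<le> width (Suc n)"
    using f gf assms(2-) shift_bounds(1,2)[of n] width_Suc_ge[of n] unfolding abs_le_iff
    by - (safe; linarith)+
  then show "g + f \<in> height (Suc n)" "g + f + shift n \<in> height (Suc n)"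
    by (simp_all add: height_def box_def del: width_Suc of_nat_Suc)
qed

interpretation heis: cut_and_stack height shift
proof
  fix n :: nat and f g :: heis
  show "finite (height n)" by (simp add: height_def)
  show "0 \<in> height n" using width_ge_1[of n] by (simp add: height_def box_def)
  show "f \<in> height (Suc n)" "f + shift n \<in> height (Suc n)" if "f \<in> height n"
    using height_Suc_translate[OF that, of 0] by auto
  \<comment> \<open>The \<open>hx\<close>- and \<open>hy\<close>-entries of box elements differ by
    at most \<open>2 * width n\<close>, whereas one such entry of the shift has size
    \<open>gap n\<close>, which is at least \<open>3 * width n\<close>.\<close>
  show "f + shift n \<notin> height n" if "f \<in> height n"
    using that shift_bounds(3)[of n] gap_ge[of n] by (auto simp: height_def box_def)
  show "\<exists>N. \<forall>n\<ge>N. \<forall>f\<in>height n. g + f \<in> height (Suc n) \<and> g + f + shift n \<in> height (Suc n)"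
    by (intro exI[of _ "nat (max \<bar>hx g\<bar> (max \<bar>hz g\<bar> \<bar>hy g\<bar>))"]) (auto intro!: height_Suc_translate)
qed

section \<open>Infinite measure and the Folner property\<close>

lemma card_height: "real (card (height n)) = (2 * real_of_int (width n) + 1) ^ 2 * (2 * real n ^ 2 + 1)"
  using width_ge_1[of n] unfolding height_def
  by (subst card_box) (simp_all add: power2_eq_square mult_ac)

text \<open>The box has at least \<open>4 ^ n\<close> elements and the levels have length
  \<open>(1/2) ^ n\<close>, so stage \<open>n\<close> has measure at least
  \<open>2 ^ n\<close>.\<close>

lemma infinite_measure: "emeasure heis.M UNIV = \<infinity>"
proof (rule heis.infinite_M)
  fix r :: real
  obtain n where n: "r < 2 ^ n" using real_arch_pow[of 2 r] by auto
  have "(4::real) ^ n = real_of_int (4 ^ n)" by simp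
  also have "\<dots> \<le> real_of_int (width n)" using width_ge_4_power by (simp only: of_int_le_iff)
  finally have w: "(4::real) ^ n \<le> width n" .
  have "real_of_int (width n) \<le> real_of_int (width n) ^ 2" using width_ge_1[of n] by (intro self_le_power) auto
  also have "\<dots> \<le> (2 * real_of_int (width n) + 1) ^ 2" using width_ge_1[of n] by (intro power_mono) auto
  also have "\<dots> * 1 \<le> real (card (height n))" unfolding card_height by (intro mult_left_mono) auto
  finally have "(4::real) ^ n \<le> real (card (height n))" using w by linarith
  then have "(4::real) ^ n * (1/2) ^ n \<le> card (height n) * (1/2::real) ^ n" by (intro mult_right_mono) auto
  then have "(2::real) ^ n \<le> card (height n) * (1/2::real) ^ n" by (simp flip: power_mult_distrib)
  with n show "\<exists>n. r \<le> card (height n) * (1/2::real) ^ n" by (intro exI[of _ n]) linarith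
qed

text \<open>\<open>B\<close> is a core whose translate stays in \<open>A\<close>: elements leaving
  \<open>A\<close> come from \<open>A - B\<close>, and elements missed by the translate lie outside
  that of \<open>B\<close>.\<close>

lemma card_sym_diff_translate_le:
  fixes g :: "'a::group_add"
  assumes "finite A" "B \<subseteq> A" "(+) g ` B \<subseteq> A"
  shows "real (card (sym_diff ((+) g ` A) A)) \<le> 2 * (real (card A) - real (card B))"
proof -
  have fin: "finite B" using assms finite_subset by blast
  have "sym_diff ((+) g ` A) A \<subseteq> (+) g ` (A - B) \<union> (A - (+) g ` B)" using assms by auto
  then have "card (sym_diff ((+) g ` A) A) \<le> card ((+) g ` (A - B) \<union> (A - (+) g ` B))"
    using assms by (intro card_mono) auto
  also have "\<dots> \<le> card ((+) g ` (A - B)) + card (A - (+) g ` B)" by (rule card_Un_le)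
  also have "\<dots> = (card A - card B) + (card A - card B)"
    using assms fin by (simp add: card_image card_Diff_subset)
  finally show ?thesis using card_mono[OF assms(1,2)] by (simp add: of_nat_diff)
qed

lemma one_minus_prod3_le:
  fixes u v w :: real
  assumes "0 \<le> u" "u \<le> 1" "0 \<le> v" "v \<le> 1" "0 \<le> w" "w \<le> 1"
  shows "1 - (1 - u) * (1 - v) * (1 - w) \<le> u + v + w"
proof -
  have "0 \<le> u * v * (1 - w)" "0 \<le> w * (u + v)" using assms by auto
  then show ?thesis by (simp add: algebra_simps)
qed

lemma one_minus_div_prod3:
  fixes a b u v w :: real
  assumes "a > 0" "b > 0"
  shows "(a - u) * (b - v) * (a - w) / (a ^ 2 * b) = (1 - u / a) * (1 - v / b) * (1 - w / a)"
proof -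
  have "(1 - u / a) * (1 - v / b) * (1 - w / a) = ((a - u) / a) * ((b - v) / b) * ((a - w) / a)"
    using assms by (simp add: diff_divide_distrib)
  then show ?thesis by (simp add: power2_eq_square mult_ac)
qed

lemma folner_height:
  "(\<lambda>n. real (card (sym_diff ((+) g ` height n) (height n))) / real (card (height n))) \<longlonglongrightarrow> 0"
proof -
  define K where "K = max \<bar>hx g\<bar> (max \<bar>hz g\<bar> \<bar>hy g\<bar>)"
  have K: "\<bar>hx g\<bar> \<le> K" "\<bar>hz g\<bar> \<le> K" "\<bar>hy g\<bar> \<le> K" "K \<ge> 0" by (auto simp: K_def)
  \<comment> \<open>The natural bound involves \<open>width n\<close>; its lower bound
    \<open>n ^ 3\<close> is substituted to get an explicit null sequence.\<close>
  define bnd where "bnd n = 2 * (2 * K / (2 * real n ^ 3 + 1) + 2 * K / (2 * real n ^ 2 + 1) + 2 * K * (1 + real n ^ 2) / (2 * real n ^ 3 + 1))"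
    for n :: nat
  have lim: "bnd \<longlonglongrightarrow> 0" unfolding bnd_def by real_asymp
  have "real (card (sym_diff ((+) g ` height n) (height n))) / real (card (height n)) \<le> bnd n"
    if n: "n \<ge> nat (2 * K + 1)" for n
  proof -
    \<comment> \<open>The core box. Translation by \<open>g\<close> changes \<open>hy f\<close> by
      \<open>hy g + hx g * hz f\<close>, hence the larger margin \<open>K * (1 + int n ^ 2)\<close>
      in that direction.\<close>
    let ?P = "width n - K" and ?Q = "int n ^ 2 - K" and ?R = "width n - K * (1 + int n ^ 2)"
    let ?N = "real_of_int (width n)"
    have n': "2 * K + 1 \<le> int n" using n by linarith
    have n1: "int n \<ge> 1" using n' K by linarith
    have "int n * 1 \<le> int n * int n" using n1 by (intro mult_left_mono) auto
    then have sq: "int n \<le> int n ^ 2" by (simp add: power2_eq_square)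
    have "K * (1 + int n ^ 2) \<le> K * (2 * int n ^ 2)" using K n1 by (intro mult_left_mono) (auto simp: one_le_power)
    also have "\<dots> = (2 * K) * int n ^ 2" by simp
    also have "\<dots> \<le> int n * int n ^ 2" using n' by (intro mult_right_mono) auto
    also have "\<dots> = int n ^ 3" by (simp add: power2_eq_square power3_eq_cube)
    also have "\<dots> \<le> width n" by (rule width_ge_cube)
    finally have R: "?R \<ge> 0" by simp
    have "K * 1 \<le> K * (1 + int n ^ 2)" using K by (intro mult_left_mono) auto
    then have P: "?P \<ge> 0" "?R \<le> ?P" using R by auto
    have Q: "?Q \<ge> 0" using sq n' K by linarith
    let ?B = "box ?P ?Q ?R"
    have mult: "\<bar>hx g * hz f\<bar> \<le> K * int n ^ 2" if "f \<in> ?B" for f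
      unfolding abs_mult using K that by (intro mult_mono) (auto simp: box_def)
    have "?B \<subseteq> height n" using K P by (auto simp: height_def box_def)
    moreover have "(+) g ` ?B \<subseteq> height n"
    proof (intro image_subsetI)
      fix f assume f: "f \<in> ?B"
      show "g + f \<in> height n"
        using mult[OF f] f K unfolding height_def box_def mem_Collect_eq heis_sel by (auto simp: algebra_simps)
    qed
    ultimately have "real (card (sym_diff ((+) g ` height n) (height n))) \<le>
        2 * (real (card (height n)) - real (card ?B))"
      by (intro card_sym_diff_translate_le) (auto simp: height_def)
    moreover have pos: "real (card (height n)) > 0"
      unfolding card_height using width_ge_1[of n]
      by (intro mult_pos_pos zero_less_power add_nonneg_pos) auto
    ultimately have "real (card (sym_diff ((+) g ` height n) (height n))) / real (card (height n)) \<le>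
        2 * (1 - real (card ?B) / real (card (height n)))"
      by (simp add: field_simps)
    also have "real (card ?B) / real (card (height n)) =
        (1 - 2 * K / (2 * ?N + 1)) * (1 - 2 * K / (2 * real n ^ 2 + 1)) * (1 - 2 * K * (1 + real n ^ 2) / (2 * ?N + 1))"
    proof -
      have "2 * ?N + 1 > 0" using width_ge_1[of n] by simp
      moreover have "2 * real n ^ 2 + 1 > 0" by (intro add_nonneg_pos) auto
      moreover have "real (card ?B) = (2 * ?N + 1 - 2 * K) * (2 * real n ^ 2 + 1 - 2 * K) *
          (2 * ?N + 1 - 2 * K * (1 + real n ^ 2))"
        using P Q R by (subst card_box) (auto simp: algebra_simps)
      ultimately show ?thesis unfolding card_height by (simp add: one_minus_div_prod3)
    qed
    also have "1 - \<dots> \<le> 2 * K / (2 * ?N + 1) + 2 * K / (2 * real n ^ 2 + 1) + 2 * K * (1 + real n ^ 2) / (2 * ?N + 1)"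
    proof (rule one_minus_prod3_le)
      have pos1: "2 * ?N + 1 > 0" using width_ge_1[of n] by simp
      have pos2: "2 * real n ^ 2 + 1 > 0" by (intro add_nonneg_pos) auto
      have *: "real_of_int K \<le> ?N" using P by simp
      have **: "K * (1 + real n ^ 2) \<le> ?N"
      proof -
        have "real_of_int (K * (1 + int n ^ 2)) \<le> ?N" using R by (simp only: of_int_le_iff)
        then show ?thesis by simp
      qed
      have ***: "real_of_int K \<le> real n ^ 2"
      proof -
        have "real_of_int K \<le> real_of_int (int n ^ 2)" using Q by (simp only: of_int_le_iff)
        then show ?thesis by simp
      qed
      show "2 * K / (2 * ?N + 1) \<le> 1" "2 * K * (1 + real n ^ 2) / (2 * ?N + 1) \<le> 1" "2 * K / (2 * real n ^ 2 + 1) \<le> 1"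
        using * ** *** pos1 pos2 by (simp_all add: divide_le_eq_1_pos algebra_simps)
    qed (use K width_ge_1[of n] in auto)
    also have "\<dots> \<le> 2 * K / (2 * real n ^ 3 + 1) + 2 * K / (2 * real n ^ 2 + 1) + 2 * K * (1 + real n ^ 2) / (2 * real n ^ 3 + 1)"
    proof -
      have "real_of_int (int n ^ 3) \<le> ?N" using width_ge_cube[of n] by (simp only: of_int_le_iff)
      then have "2 * real n ^ 3 + 1 \<le> 2 * ?N + 1" by simp
      moreover have "2 * real n ^ 3 + 1 > 0" by (intro add_nonneg_pos) auto
      ultimately show ?thesis using K by (intro add_mono order_refl divide_left_mono) auto
    qed
    finally show ?thesis by (simp add: bnd_def)
  qed
  then have "eventually (\<lambda>n. real (card (sym_diff ((+) g ` height n) (height n))) / real (card (height n)) \<le> bnd n) sequentially"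
    by (auto simp: eventually_sequentially)
  then show ?thesis by (intro tendsto_sandwich[OF _ _ tendsto_const lim]) auto
qed

section \<open>Returns to the base level\<close>

lemma offspring_bounds:
  assumes "h \<in> heis.offspring n 0 k"
  shows "hz h = 0" "\<bar>hx h\<bar> \<le> width (n + k)" "\<bar>hy h\<bar> \<le> width (n + k)"
proof -
  show "hz h = 0" using assms by (induction k arbitrary: h) auto
  have "h \<in> height (n + k)" using assms heis.offspring_F[OF heis.zero_F, of n k] by blast
  then show "\<bar>hx h\<bar> \<le> width (n + k)" "\<bar>hy h\<bar> \<le> width (n + k)" by (auto simp: height_def box_def)
qed

lemma hz_offspring: "h \<in> heis.offspring n f k \<Longrightarrow> hz h = hz f"
  by (induction k arbitrary: h) auto

text \<open>Common final shifts cancel on the right. The index \<open>j\<close> is the last stage at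
  which exactly one of the two labels uses its shift; what precedes it lies in the box of stage
  \<open>j\<close> and contributes at most \<open>2 * width j\<close>.\<close>

lemma offspring_difference:
  assumes "h \<in> heis.offspring n 0 k" "h' \<in> heis.offspring n 0 k" "h' \<noteq> h"
  shows "\<exists>j\<ge>n. \<exists>s\<in>{1, -1}. \<bar>hx (h' - h) - s * hx (shift j)\<bar> \<le> 2 * width j \<and>
    \<bar>hy (h' - h) - s * hy (shift j)\<bar> \<le> 2 * width j"
  using assms
proof (induction k arbitrary: h h')
  case (Suc k)
  have opposite: ?case if "u \<in> heis.offspring n 0 k" "u' \<in> heis.offspring n 0 k"
    "h = u \<and> h' = u' + shift (n + k) \<or> h = u + shift (n + k) \<and> h' = u'" for u u'
    using that offspring_bounds[OF that(1)] offspring_bounds[OF that(2)]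
    by (intro exI[of _ "n + k"]) auto
  consider u u' where "u \<in> heis.offspring n 0 k" "u' \<in> heis.offspring n 0 k" "u' \<noteq> u"
      "h' - h = u' - u"
    | u u' where "u \<in> heis.offspring n 0 k" "u' \<in> heis.offspring n 0 k"
      "h = u \<and> h' = u' + shift (n + k) \<or> h = u + shift (n + k) \<and> h' = u'"
  proof -
    have "(u' + shift (n + k)) - (u + shift (n + k)) = u' - u" for u u'
      by (simp add: diff_add_eq_diff_diff_swap)
    then show ?thesis using Suc.prems that by auto
  qed
  then show ?case
  proof cases
    case 1
    then show ?thesis using Suc.IH[of u u'] by metis
  next
    case 2
    then show ?thesis using opposite by blast
  qed
qed simp

lemma dist_to_ints:
  fixes t :: real
  assumes "t \<notin> \<int>"
  obtains \<delta> where "0 < \<delta>" "\<delta> \<le> 1" "\<And>l::int. \<bar>l - t\<bar> \<ge> \<delta>"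
proof
  have "frac t > 0" "frac t < 1" using assms frac_lt_1 frac_gt_0_iff by auto
  then show "0 < min (frac t) (1 - frac t)" "min (frac t) (1 - frac t) \<le> 1" by auto
  show "\<bar>real_of_int l - t\<bar> \<ge> min (frac t) (1 - frac t)" for l
  proof (cases "l \<le> \<lfloor>t\<rfloor>")
    case True
    then have "real_of_int l \<le> real_of_int \<lfloor>t\<rfloor>" by simp
    then show ?thesis unfolding frac_def by linarith
  next
    case False
    then have "real_of_int l \<ge> real_of_int (\<lfloor>t\<rfloor> + 1)" by (simp only: of_int_le_iff)
    then show ?thesis unfolding frac_def by simp
  qed
qed

lemma hz_return:
  assumes "x \<in> heis.level n 0" "heis.act g x \<in> heis.level n 0"
  shows "hz g = 0"
  using heis.return_offspring[OF heis.zero_F assms] offspring_bounds(1) by (metis diff_0_right heis_sel(11))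

text \<open>A return is some \<open>shift j\<close> or its inverse up to \<open>2 * width j\<close>.
  A shift deviates from slope \<open>t\<close> by at least \<open>\<delta> * gap j\<close>, and the
  error by at most \<open>2 * (1 + \<bar>t\<bar>) * width j\<close>; since \<open>gap j\<close> is
  \<open>int j + 3\<close> times \<open>width j\<close>, the main term wins for large
  \<open>j\<close>.\<close>

lemma return_off_slope:
  fixes t :: real
  assumes "t \<notin> \<int>"
  obtains n where "\<And>x g. x \<in> heis.level n 0 \<Longrightarrow> heis.act g x \<in> heis.level n 0 \<Longrightarrow> g \<noteq> 0 \<Longrightarrow>
    \<bar>hy g - t * hx g\<bar> \<ge> 1 + \<bar>t\<bar>"
proof -
  obtain \<delta> where \<delta>: "0 < \<delta>" "\<delta> \<le> 1" "\<And>l::int. \<bar>l - t\<bar> \<ge> \<delta>" using dist_to_ints[OF assms] by blast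
  define C where "C = 1 + \<bar>t\<bar>"
  have C: "C \<ge> 1" by (simp add: C_def)
  \<comment> \<open>Of the factor 3, two parts absorb the error \<open>2 * C\<close> and one remains
    as the asserted bound \<open>C\<close>.\<close>
  obtain n where n: "3 * C / \<delta> < real n" using reals_Archimedean2 by blast
  show ?thesis
  proof (rule that)
    fix x g assume x: "x \<in> heis.level n 0" "heis.act g x \<in> heis.level n 0" "g \<noteq> 0"
    obtain k h h' where h: "h \<in> heis.offspring n 0 k" "h' \<in> heis.offspring n 0 k" "g = h' - h"
      using heis.return_offspring[OF heis.zero_F x(1,2)] by blast
    then have "h' \<noteq> h" using x(3) by auto
    then obtain j s where j: "j \<ge> n" "s \<in> {1, -1::int}" "\<bar>hx g - s * hx (shift j)\<bar> \<le> 2 * width j"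
      "\<bar>hy g - s * hy (shift j)\<bar> \<le> 2 * width j" using offspring_difference[OF h(1,2)] h(3) by blast
    let ?w = "real_of_int (width j)"
    have w: "?w \<ge> 1" using width_ge_1[of j] by simp
    have gap: "real_of_int (gap j) = (real j + 3) * ?w" by (simp add: gap_def)
    have gpos: "real_of_int (gap j) > 0" using gap_ge(2)[of j] by simp
    have c: "\<bar>hy (shift j) - t * hx (shift j)\<bar> \<ge> \<delta> * gap j"
    proof (cases j rule: shift_cases)
      case (1 l)
      have "\<bar>hy (shift j) - t * hx (shift j)\<bar> = \<bar>l - t\<bar> * gap j"
        using 1 gpos by (simp add: abs_mult flip: left_diff_distrib)
      then show ?thesis using \<delta>(3)[of l] gpos by (simp add: mult_right_mono)
    next
      case 2
      then show ?thesis using \<delta> gpos by simp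
    qed
    have "\<bar>real_of_int (hx g - s * hx (shift j))\<bar> \<le> 2 * ?w" "\<bar>real_of_int (hy g - s * hy (shift j))\<bar> \<le> 2 * ?w"
      using j(3,4) by linarith+
    then have a: "\<bar>hx g - real_of_int s * hx (shift j)\<bar> \<le> 2 * ?w" "\<bar>hy g - real_of_int s * hy (shift j)\<bar> \<le> 2 * ?w"
      by simp_all
    have ta: "\<bar>t * (hx g - real_of_int s * hx (shift j))\<bar> \<le> \<bar>t\<bar> * (2 * ?w)"
      unfolding abs_mult using a(1) by (intro mult_left_mono) auto
    have "\<bar>real_of_int s * (hy (shift j) - t * hx (shift j))\<bar> \<ge> \<delta> * gap j"
      using c j(2) by (auto simp: abs_mult)
    moreover have "hy g - t * hx g = real_of_int s * (hy (shift j) - t * hx (shift j)) +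
      (hy g - real_of_int s * hy (shift j)) - t * (hx g - real_of_int s * hx (shift j))"
      by (simp add: algebra_simps)
    ultimately have "\<bar>hy g - t * hx g\<bar> \<ge> \<delta> * gap j - 2 * ?w - \<bar>t\<bar> * (2 * ?w)"
      using a(2) ta by linarith
    also have "\<delta> * gap j - 2 * ?w - \<bar>t\<bar> * (2 * ?w) = (\<delta> * (real j + 3) - 2 * C) * ?w"
      by (simp add: gap C_def algebra_simps)
    finally have "\<bar>hy g - t * hx g\<bar> \<ge> (\<delta> * (real j + 3) - 2 * C) * ?w" .
    moreover have "\<delta> * (real j + 3) - 2 * C \<ge> C"
    proof -
      have "3 * C < \<delta> * real n" using n \<delta> by (simp add: field_simps)
      also have "\<dots> \<le> \<delta> * (real j + 3)" using j(1) \<delta> by (intro mult_left_mono) auto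
      finally show ?thesis by simp
    qed
    then have "(\<delta> * (real j + 3) - 2 * C) * ?w \<ge> C * 1" using C w by (intro mult_mono) auto
    ultimately show "\<bar>hy g - t * hx g\<bar> \<ge> 1 + \<bar>t\<bar>" by (simp add: C_def)
  qed
qed

section \<open>Recurrence in the integer slopes and the centre\<close>

text \<open>For \<open>b = s * a\<close> slope \<open>s\<close> becomes \<open>s - hz g\<close>:
  lattice conjugation permutes the integer slopes, and it fixes central elements
  (\<open>a = 0\<close>).\<close>

lemma conjugate_shift:
  "g + Heis a 0 b - g = Heis a 0 (b - a * hz g)"
  by (rule heis.expand) (simp add: algebra_simps)

lemma recurrent_slope:
  assumes "A \<in> sets borel" "emeasure heis.M A > 0"
  shows "\<exists>a>0. 0 < emeasure heis.M (A \<inter> heis.act (Heis a 0 (l * a)) ` A)"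
proof -
  obtain n f where f: "f \<in> height n"
    "\<And>k. \<exists>h\<in>heis.offspring n f k. 0 < emeasure heis.M (A \<inter> heis.act (h + shift (n + k) - h) ` A)"
    using heis.returns_of_offspring[OF assms] by metis
  \<comment> \<open>All descendants of \<open>f\<close> share its \<open>hz\<close>-entry, so
    conjugation by any of them turns slope \<open>l + hz f\<close> into \<open>l\<close>.\<close>
  obtain k where k: "shift (n + k) = Heis (gap (n + k)) 0 ((l + hz f) * gap (n + k))"
    using shift_slope by blast
  obtain h where "h \<in> heis.offspring n f k" "0 < emeasure heis.M (A \<inter> heis.act (h + shift (n + k) - h) ` A)"
    using f by blast
  moreover have "h + shift (n + k) - h = Heis (gap (n + k)) 0 (l * gap (n + k))"
    unfolding k conjugate_shift hz_offspring[OF calculation(1)] by (simp add: algebra_simps)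
  ultimately show ?thesis using gap_ge(2)[of "n + k"] by (intro exI[of _ "gap (n + k)"]) simp
qed

lemma recurrent_central:
  assumes "A \<in> sets borel" "emeasure heis.M A > 0"
  shows "\<exists>b>0. 0 < emeasure heis.M (A \<inter> heis.act (Heis 0 0 b) ` A)"
proof -
  obtain n f where f: "f \<in> height n"
    "\<And>k. \<exists>h\<in>heis.offspring n f k. 0 < emeasure heis.M (A \<inter> heis.act (h + shift (n + k) - h) ` A)"
    using heis.returns_of_offspring[OF assms] by metis
  obtain k where k: "shift (n + k) = Heis 0 0 (gap (n + k))" using shift_central by blast
  obtain h where "0 < emeasure heis.M (A \<inter> heis.act (h + shift (n + k) - h) ` A)" using f by blast
  then show ?thesis using gap_ge(2)[of "n + k"] unfolding k conjugate_shift
    by (intro exI[of _ "gap (n + k)"]) simp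
qed

section \<open>Lines, matrices and the action\<close>

definition hmat :: "real \<Rightarrow> real \<Rightarrow> real \<Rightarrow> real^3^3" where
  "hmat x z y = vector [vector [1, x, y], vector [0, 1, z], vector [0, 0, 1]]"

definition lmat :: "real \<Rightarrow> real \<Rightarrow> real \<Rightarrow> real^3^3" where
  "lmat x z y = vector [vector [0, x, y], vector [0, 0, z], vector [0, 0, 0]]"

lemma hmat_nth [simp]:
  "hmat x z y $ 1 $ 1 = 1" "hmat x z y $ 1 $ 2 = x" "hmat x z y $ 1 $ 3 = y"
  "hmat x z y $ 2 $ 1 = 0" "hmat x z y $ 2 $ 2 = 1" "hmat x z y $ 2 $ 3 = z"
  "hmat x z y $ 3 $ 1 = 0" "hmat x z y $ 3 $ 2 = 0" "hmat x z y $ 3 $ 3 = 1"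
  by (simp_all add: hmat_def vector_3)

lemma lmat_nth [simp]:
  "lmat x z y $ 1 $ 1 = 0" "lmat x z y $ 1 $ 2 = x" "lmat x z y $ 1 $ 3 = y"
  "lmat x z y $ 2 $ 1 = 0" "lmat x z y $ 2 $ 2 = 0" "lmat x z y $ 2 $ 3 = z"
  "lmat x z y $ 3 $ 1 = 0" "lmat x z y $ 3 $ 2 = 0" "lmat x z y $ 3 $ 3 = 0"
  by (simp_all add: lmat_def vector_3)

lemma mat3_eqI:
  fixes A B :: "real^3^3"
  assumes "A $ 1 $ 1 = B $ 1 $ 1" "A $ 1 $ 2 = B $ 1 $ 2" "A $ 1 $ 3 = B $ 1 $ 3"
    "A $ 2 $ 1 = B $ 2 $ 1" "A $ 2 $ 2 = B $ 2 $ 2" "A $ 2 $ 3 = B $ 2 $ 3"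
    "A $ 3 $ 1 = B $ 3 $ 1" "A $ 3 $ 2 = B $ 3 $ 2" "A $ 3 $ 3 = B $ 3 $ 3"
  shows "A = B"
  using assms by (simp add: vec_eq_iff forall_3)

lemma hmat_eq_iff [simp]: "hmat x z y = hmat x' z' y' \<longleftrightarrow> x = x' \<and> z = z' \<and> y = y'"
  by (metis hmat_nth(2,3,6))

lemma lmat_eq_iff [simp]: "lmat x z y = lmat x' z' y' \<longleftrightarrow> x = x' \<and> z = z' \<and> y = y'"
  by (metis lmat_nth(2,3,6))

lemma hmat_mult: "hmat x z y ** hmat x' z' y' = hmat (x + x') (z + z') (y + y' + x * z')"
  by (rule mat3_eqI) (simp_all add: matrix_matrix_mult_def sum_3)

lemma mat_1_hmat: "mat 1 = hmat 0 0 0"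
  by (rule mat3_eqI) (simp_all add: mat_def)

lemma hmat_inv: "matrix_inv (hmat x z y) = hmat (- x) (- z) (- y + x * z)"
proof -
  let ?k = "hmat (- x) (- z) (- y + x * z)"
  have k: "hmat x z y ** ?k = mat 1" "?k ** hmat x z y = mat 1"
    by (simp_all add: hmat_mult mat_1_hmat)
  then have "hmat x z y ** matrix_inv (hmat x z y) = mat 1"
    unfolding matrix_inv_def by (metis (mono_tags, lifting) someI_ex)
  then show ?thesis using k by (metis matrix_mul_assoc matrix_mul_lid matrix_mul_rid)
qed

lemma H3R_hmat: "H3R = {hmat x z y | x z y. True}"
proof
  show "H3R \<subseteq> {hmat x z y | x z y. True}"
  proof
    fix g assume "g \<in> H3R"
    then have "g = hmat (g $ 1 $ 2) (g $ 2 $ 3) (g $ 1 $ 3)"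
      by (intro mat3_eqI) (simp_all add: H3R_def)
    then show "g \<in> {hmat x z y | x z y. True}" by blast
  qed
qed (auto simp: H3R_def)

lemma h3R_lmat: "h3R = {lmat x z y | x z y. True}"
proof
  show "h3R \<subseteq> {lmat x z y | x z y. True}"
  proof
    fix g assume "g \<in> h3R"
    then have "g = lmat (g $ 1 $ 2) (g $ 2 $ 3) (g $ 1 $ 3)"
      by (intro mat3_eqI) (simp_all add: h3R_def)
    then show "g \<in> {lmat x z y | x z y. True}" by blast
  qed
qed (auto simp: h3R_def)

lemma hmat_H3R [simp]: "hmat x z y \<in> H3R"
  by (auto simp: H3R_hmat)

lemma scaleR_lmat: "s *\<^sub>R lmat x z y = lmat (s * x) (s * z) (s * y)"
  by (rule mat3_eqI) simp_all

lemma span_lmat: "span {lmat x z y} = range (\<lambda>s. lmat (s * x) (s * z) (s * y))"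
  by (simp add: span_singleton scaleR_lmat)

lemma theta_lmat: "theta t = span {lmat 1 0 t}" and theta_inf_lmat: "theta_inf = span {lmat 0 0 1}"
  by (simp_all add: theta_def theta_inf_def lmat_def)

lemma lmat_mult: "lmat x z y ** lmat x' z' y' = lmat 0 0 (x * z')"
  by (rule mat3_eqI) (simp_all add: matrix_matrix_mult_def sum_3)

text \<open>Third powers vanish, so the series stops at the quadratic term, which is
  central.\<close>

lemma mat_exp_lmat: "mat_exp (lmat x z y) = hmat x z (y + x * z / 2)"
proof -
  let ?v = "lmat x z y"
  let ?p = "\<lambda>n. ((\<lambda>w. ?v ** w) ^^ n) (mat 1)"
  have p2: "?p 1 = ?v" "?p 2 = lmat 0 0 (x * z)" "?p 3 = 0"
    by (simp_all add: numeral_2_eq_2 numeral_3_eq_3 lmat_mult) (rule mat3_eqI; simp)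
  have "?p n = 0" if "n \<ge> 3" for n
    using that
  proof (induction n rule: dec_induct)
    case (step n)
    then show ?case by (simp add: matrix_matrix_mult_def vec_eq_iff)
  qed (rule p2)
  then have "mat_exp ?v = (\<Sum>n<3. (1 / fact n) *\<^sub>R ?p n)"
    unfolding mat_exp_def by (intro suminf_finite) auto
  also have "\<dots> = mat 1 + ?v + (1/2) *\<^sub>R lmat 0 0 (x * z)"
    using p2 by (simp add: numeral_3_eq_3 numeral_2_eq_2)
  also have "\<dots> = hmat x z (y + x * z / 2)"
    by (rule mat3_eqI) (simp_all add: mat_1_hmat)
  finally show ?thesis .
qed

lemma Ad_lmat: "Ad (hmat a c b) (lmat x z y) = lmat x z (y + a * z - c * x)"
  unfolding Ad_def hmat_inv
  by (rule mat3_eqI) (simp_all add: matrix_matrix_mult_def sum_3 algebra_simps)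

lemma Ad_span: "Ad (hmat a c b) ` span {lmat x z y} = span {lmat x z (y + a * z - c * x)}"
  unfolding span_lmat image_image by (simp add: Ad_lmat algebra_simps)

lemma span_lmat_P:
  assumes "(x, z, y) \<noteq> (0, 0, 0)"
  shows "span {lmat x z y} \<in> P_h3R"
proof -
  have "lmat x z y \<noteq> 0" using assms by (metis lmat_nth(2,3,6) zero_index)
  moreover have "span {lmat x z y} \<subseteq> h3R" by (auto simp: span_lmat h3R_lmat)
  ultimately show ?thesis by (simp add: P_h3R_def subspace_span dim_span dim_singleton)
qed

lemma P_h3R_span:
  assumes "\<theta> \<in> P_h3R"
  obtains x z y where "\<theta> = span {lmat x z y}" "(x, z, y) \<noteq> (0, 0, 0)"
proof -
  have \<theta>: "subspace \<theta>" "\<theta> \<subseteq> h3R" "dim \<theta> = 1" using assms by (auto simp: P_h3R_def)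
  obtain B where B: "B \<subseteq> \<theta>" "independent B" "\<theta> \<subseteq> span B" "card B = dim \<theta>"
    using basis_exists by blast
  then obtain v where v: "B = {v}" using \<theta>(3) card_1_singletonE by metis
  then have "\<theta> = span {v}" using B \<theta>(1) by (metis span_minimal subset_antisym)
  moreover have "v \<noteq> 0" using B(2) v dependent_zero by blast
  moreover obtain x z y where "v = lmat x z y" using B(1) v \<theta>(2) by (auto simp: h3R_lmat)
  moreover have "lmat 0 0 0 = 0" by (rule mat3_eqI) simp_all
  ultimately show ?thesis using that by auto
qed

lemma span_lmat_scale:
  assumes "r \<noteq> 0"
  shows "span {lmat (r * x) (r * z) (r * y)} = span {lmat x z y}"
  unfolding span_lmat
proof (intro equalityI image_subsetI)
  fix s
  show "lmat (s * (r * x)) (s * (r * z)) (s * (r * y)) \<in> range (\<lambda>s. lmat (s * x) (s * z) (s * y))"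
    by (rule image_eqI[of _ _ "s * r"]) simp_all
  show "lmat (s * x) (s * z) (s * y) \<in> range (\<lambda>s. lmat (s * (r * x)) (s * (r * z)) (s * (r * y)))"
    using assms by (intro image_eqI[of _ _ "s / r"]) simp_all
qed

lemma theta_eq_iff [simp]: "theta s = theta t \<longleftrightarrow> s = t"
proof
  assume "theta s = theta t"
  moreover have "lmat 1 0 s \<in> theta s" unfolding theta_lmat by (rule span_base) simp
  ultimately show "s = t" by (auto simp: theta_lmat span_lmat)
qed simp

lemma theta_neq_theta_inf [simp]: "theta t \<noteq> theta_inf"
proof
  assume "theta t = theta_inf"
  moreover have "lmat 1 0 t \<in> theta t" unfolding theta_lmat by (rule span_base) simp
  ultimately show False by (auto simp: theta_inf_lmat span_lmat)
qed

section \<open>The lattice and the metric\<close>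

definition embed :: "heis \<Rightarrow> real^3^3" where
  "embed g = hmat (hx g) (hz g) (hy g)"

definition unembed :: "real^3^3 \<Rightarrow> heis" where
  "unembed A = Heis \<lfloor>A $ 1 $ 2\<rfloor> \<lfloor>A $ 2 $ 3\<rfloor> \<lfloor>A $ 1 $ 3\<rfloor>"

lemma unembed_embed [simp]: "unembed (embed g) = g"
  by (simp add: unembed_def embed_def)

lemma embed_eq_iff [simp]: "embed g = embed h \<longleftrightarrow> g = h"
  by (metis unembed_embed)

lemma embed_add: "embed (g + h) = embed g ** embed h"
  by (simp add: embed_def hmat_mult)

lemma embed_0: "embed 0 = mat 1"
  by (simp add: embed_def mat_1_hmat)

lemma H3Z_embed: "H3Z = range embed"
proof
  show "H3Z \<subseteq> range embed"
  proof
    fix A assume A: "A \<in> H3Z"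
    then obtain x z y where xyz: "A = hmat x z y" by (auto simp: H3Z_def H3R_hmat)
    have "\<forall>i j. A $ i $ j \<in> \<int>" using A by (simp add: H3Z_def)
    then have "x \<in> \<int>" "z \<in> \<int>" "y \<in> \<int>" unfolding xyz by (metis hmat_nth)+
    then obtain a c b :: int where "x = a" "z = c" "y = b" by (metis Ints_cases)
    then show "A \<in> range embed" using xyz by (intro image_eqI[of _ _ "Heis a c b"]) (auto simp: embed_def)
  qed
  show "range embed \<subseteq> H3Z"
    by (auto simp: embed_def H3Z_def forall_3)
qed

text \<open>By right invariance the distance of two matrices is that of their quotient from
  \<open>mat 1\<close>; the three quantities are the entries of this quotient above the
  diagonal.\<close>

lemma metric_small:
  assumes "right_invariant_metric d" "\<eta> > 0"
  obtains \<epsilon> where "\<epsilon> > 0"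
    "\<And>x z y x' z' y'. d (hmat x z y) (hmat x' z' y') < \<epsilon> \<Longrightarrow>
       \<bar>x - x'\<bar> < \<eta> \<and> \<bar>z - z'\<bar> < \<eta> \<and> \<bar>y - y' - (x - x') * z'\<bar> < \<eta>"
proof -
  interpret Metric_space H3R d using assms by (simp add: right_invariant_metric_def)
  let ?W = "{A :: real^3^3. \<bar>A $ 1 $ 2\<bar> < \<eta> \<and> \<bar>A $ 2 $ 3\<bar> < \<eta> \<and> \<bar>A $ 1 $ 3\<bar> < \<eta>}"
  have "open ?W" by (intro open_Collect_conj open_Collect_less continuous_intros)
  then have "openin mtopology (H3R \<inter> ?W)"
    using assms by (simp add: right_invariant_metric_def openin_open_Int)
  moreover have "mat 1 \<in> H3R \<inter> ?W" using assms by (simp add: mat_1_hmat)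
  ultimately obtain \<epsilon> where \<epsilon>: "\<epsilon> > 0" "mball (mat 1) \<epsilon> \<subseteq> H3R \<inter> ?W"
    unfolding openin_mtopology by blast
  show ?thesis
  proof (rule that[OF \<epsilon>(1)])
    fix x z y x' z' y' assume d: "d (hmat x z y) (hmat x' z' y') < \<epsilon>"
    let ?k = "hmat (- x') (- z') (- y' + x' * z')"
    have "d (hmat x z y ** ?k) (hmat x' z' y' ** ?k) = d (hmat x z y) (hmat x' z' y')"
      using assms by (simp add: right_invariant_metric_def)
    then have "hmat x z y ** ?k \<in> mball (mat 1) \<epsilon>"
      using d by (simp add: hmat_mult mat_1_hmat commute)
    then have "hmat x z y ** ?k \<in> ?W" using \<epsilon>(2) by blast
    then show "\<bar>x - x'\<bar> < \<eta> \<and> \<bar>z - z'\<bar> < \<eta> \<and> \<bar>y - y' - (x - x') * z'\<bar> < \<eta>"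
      by (simp add: hmat_mult algebra_simps)
  qed
qed

section \<open>The action is measure preserving, free and of rank one\<close>

definition T :: "real^3^3 \<Rightarrow> real \<Rightarrow> real" where
  "T A = heis.act (unembed A)"

lemma T_embed [simp]: "T (embed g) = heis.act g"
  by (simp add: T_def)

lemma T_embed_level: "g \<in> height n \<Longrightarrow> T (embed g) ` heis.level n 0 = heis.level n g"
  using heis.act_level[of 0 n g] heis.zero_F by simp

lemma mp_action_T: "mp_action heis.M T"
proof -
  have "sets heis.M = sigma_sets (space heis.M) {U. openin euclidean U}"
    by (simp add: borel_def sets_measure_of)
  moreover have "second_countable (euclidean :: real topology)"
  proof -
    obtain B :: "real set set" where B: "countable B" "topological_basis B"
      using ex_countable_basis by blast
    have "\<exists>V\<in>B. x \<in> V \<and> V \<subseteq> U" if "open U" "x \<in> U" for U x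
      by (rule topological_basisE[OF B(2) that]) blast
    moreover have "\<forall>V\<in>B. open V" using topological_basis_open[OF B(2)] by blast
    ultimately show ?thesis using B(1) unfolding second_countable_def open_openin[symmetric] by blast
  qed
  ultimately have "standard_measure_space heis.M"
    unfolding standard_measure_space_def using heis.sigma_finite_M
    by (intro conjI exI[of _ euclidean]) (auto simp: completely_metrizable_space_euclidean)
  then show ?thesis
    unfolding mp_action_def H3Z_embed
    by (auto simp: heis.distr_act heis.act_zero heis.act_add simp flip: embed_0 embed_add)
qed

lemma free_action_T: "free_action heis.M T"
  unfolding free_action_def
proof
  fix \<gamma> assume "\<gamma> \<in> H3Z - {mat 1}"
  then obtain g where g: "\<gamma> = embed g" "g \<noteq> 0" by (auto simp: H3Z_embed simp flip: embed_0)
  have "AE x in lborel. x \<in> heis.carrier \<longrightarrow> heis.act g x \<noteq> x"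
    using g(2) heis.act_fixed_point by (intro AE_I2) blast
  then show "AE x in heis.M. T \<gamma> x \<noteq> x"
    unfolding g heis.M_def by (subst AE_density) (auto simp: indicator_def)
qed

lemma Folner_sequence_height: "Folner_sequence (\<lambda>n. embed ` height n)"
  unfolding Folner_sequence_def
proof (intro conjI allI ballI)
  fix n
  show "finite (embed ` height n)" by (simp add: heis.finite_F)
  show "embed ` height n \<noteq> {}" using heis.zero_F by blast
  show "embed ` height n \<subseteq> H3Z" by (auto simp: H3Z_embed)
next
  fix \<gamma> assume "\<gamma> \<in> H3Z"
  then obtain g where g: "\<gamma> = embed g" by (auto simp: H3Z_embed)
  have inj: "inj embed" by (simp add: inj_def)
  have "sym_diff ((\<lambda>\<delta>. \<gamma> ** \<delta>) ` embed ` height n) (embed ` height n) =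
      embed ` sym_diff ((+) g ` height n) (height n)" for n
    by (simp add: g image_image flip: embed_add) (simp add: image_Un image_set_diff[OF inj] image_image)
  then show "(\<lambda>n. real (card (sym_diff ((\<lambda>\<delta>. \<gamma> ** \<delta>) ` embed ` height n) (embed ` height n))) /
      real (card (embed ` height n))) \<longlonglongrightarrow> 0"
    using folner_height[of g] by (simp add: card_image inj_on_subset[OF inj])
qed

text \<open>The tower of stage \<open>n\<close> has as its base the level labelled by the identity;
  the other levels are its translates.\<close>

lemma rank_one_T: "rank_one heis.M T"
  unfolding rank_one_def
proof (intro exI conjI allI ballI impI)
  show "Folner_sequence (\<lambda>n. embed ` height n)" by (rule Folner_sequence_height)
  fix n
  show "heis.level n 0 \<in> sets heis.M" by simp
  show "0 < emeasure heis.M (heis.level n 0)" "emeasure heis.M (heis.level n 0) < \<infinity>"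
    using heis.emeasure_level[OF heis.zero_F] by auto
  show "disjoint_family_on (\<lambda>\<gamma>. T \<gamma> ` heis.level n 0) (embed ` height n)"
    using heis.level_disjoint_family[of n] T_embed_level by (auto simp: disjoint_family_on_def)
next
  fix A assume A: "A \<in> sets heis.M" "emeasure heis.M A < \<infinity>"
  have "(\<lambda>E. emeasure heis.M (sym_diff A (\<Union>\<gamma>\<in>E. T \<gamma> ` heis.level n 0))) ` Pow (embed ` height n) =
      (\<lambda>E. emeasure heis.M (sym_diff A (heis.tower n E))) ` Pow (height n)" for n
  proof -
    have "(\<Union>\<gamma>\<in>embed ` E. T \<gamma> ` heis.level n 0) = heis.tower n E" if "E \<subseteq> height n" for E
      unfolding heis.tower_def image_image using T_embed_level that by (intro SUP_cong) auto
    moreover have "Pow (embed ` height n) = (\<lambda>E. embed ` E) ` Pow (height n)" by (rule image_Pow_surj[symmetric]) simp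
    ultimately show ?thesis by (simp add: image_image del: UN_simps image_UN cong: image_cong_simp)
  qed
  then show "(\<lambda>n. Min ((\<lambda>E. emeasure heis.M (sym_diff A (\<Union>\<gamma>\<in>E. T \<gamma> ` heis.level n 0))) `
      Pow (embed ` height n))) \<longlonglongrightarrow> 0"
    using heis.approximation_tendsto A by simp
qed

section \<open>Recurrent directions\<close>

text \<open>If the returning lattice element itself lies on the exponential of the line, its
  distance is zero and every \<open>\<epsilon>\<close> is met at once.\<close>

lemma recurrent_along_exact:
  assumes "right_invariant_metric d"
    and "\<And>A. A \<in> sets borel \<Longrightarrow> emeasure heis.M A > 0 \<Longrightarrow>
      \<exists>g. g \<noteq> 0 \<and> embed g \<in> mat_exp ` \<theta> \<and> 0 < emeasure heis.M (A \<inter> heis.act g ` A)"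
  shows "recurrent_along d heis.M T \<theta>"
  unfolding recurrent_along_def
proof (intro allI impI ballI)
  fix \<epsilon> :: real and A assume \<epsilon>: "\<epsilon> > 0" and A: "A \<in> sets heis.M" "0 < emeasure heis.M A"
  interpret Metric_space H3R d using assms by (simp add: right_invariant_metric_def)
  obtain g where g: "g \<noteq> 0" "embed g \<in> mat_exp ` \<theta>" "0 < emeasure heis.M (A \<inter> heis.act g ` A)"
    using assms(2)[of A] A by auto
  have "d (embed g) (embed g) = 0" by (simp add: embed_def)
  moreover have "embed g \<in> H3Z - {mat 1}" using g(1) by (auto simp: H3Z_embed simp flip: embed_0)
  ultimately show "\<exists>\<gamma>\<in>H3Z - {mat 1}. \<exists>g\<in>mat_exp ` \<theta>. d \<gamma> g < \<epsilon> \<and> 0 < emeasure heis.M (A \<inter> T \<gamma> ` A)"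
    using g \<epsilon> by (intro bexI[of _ "embed g"]) auto
qed

lemma recurrent_along_theta:
  assumes "right_invariant_metric d"
  shows "recurrent_along d heis.M T (theta (of_int l))"
proof (rule recurrent_along_exact[OF assms])
  fix A assume "A \<in> sets borel" "emeasure heis.M A > 0"
  then obtain a where a: "a > 0" "0 < emeasure heis.M (A \<inter> heis.act (Heis a 0 (l * a)) ` A)"
    using recurrent_slope by blast
  have "embed (Heis a 0 (l * a)) = mat_exp (lmat (real_of_int a * 1) (real_of_int a * 0) (real_of_int a * l))"
    by (simp add: embed_def mat_exp_lmat)
  moreover have "lmat (real_of_int a * 1) (real_of_int a * 0) (real_of_int a * l) \<in> theta l" unfolding theta_lmat span_lmat by blast
  moreover have "Heis a 0 (l * a) \<noteq> 0" using a(1) by (simp add: zero_heis_def)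
  ultimately show "\<exists>g. g \<noteq> 0 \<and> embed g \<in> mat_exp ` theta l \<and> 0 < emeasure heis.M (A \<inter> heis.act g ` A)"
    using a(2) by blast
qed

lemma recurrent_along_theta_inf:
  assumes "right_invariant_metric d"
  shows "recurrent_along d heis.M T theta_inf"
proof (rule recurrent_along_exact[OF assms])
  fix A assume "A \<in> sets borel" "emeasure heis.M A > 0"
  then obtain b where b: "b > 0" "0 < emeasure heis.M (A \<inter> heis.act (Heis 0 0 b) ` A)"
    using recurrent_central by blast
  have "embed (Heis 0 0 b) = mat_exp (lmat (real_of_int b * 0) (real_of_int b * 0) (real_of_int b * 1))"
    by (simp add: embed_def mat_exp_lmat)
  moreover have "lmat (real_of_int b * 0) (real_of_int b * 0) (real_of_int b * 1) \<in> theta_inf" unfolding theta_inf_lmat span_lmat by blast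
  moreover have "Heis 0 0 b \<noteq> 0" using b(1) by (simp add: zero_heis_def)
  ultimately show "\<exists>g. g \<noteq> 0 \<and> embed g \<in> mat_exp ` theta_inf \<and> 0 < emeasure heis.M (A \<inter> heis.act g ` A)"
    using b(2) by blast
qed

section \<open>Directions without recurrence\<close>

text \<open>Recurrence is tested on the base level of a stage \<open>n\<close> left to the caller;
  there every return has \<open>hz g = 0\<close>.\<close>

lemma recurrent_level:
  assumes "recurrent_along d heis.M T (span {lmat x z y})" "\<epsilon> > 0"
  obtains g p s where "g \<noteq> 0" "p \<in> heis.level n 0" "heis.act g p \<in> heis.level n 0" "hz g = 0"
    "d (hmat (hx g) 0 (hy g)) (hmat (s * x) (s * z) (s * y + s * x * (s * z) / 2)) < \<epsilon>"
proof -
  have "0 < emeasure heis.M (heis.level n 0)" using heis.emeasure_level[OF heis.zero_F, of n] by simp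
  then obtain \<gamma> v where \<gamma>: "\<gamma> \<in> H3Z - {mat 1}" "v \<in> span {lmat x z y}" "d \<gamma> (mat_exp v) < \<epsilon>"
    "0 < emeasure heis.M (heis.level n 0 \<inter> T \<gamma> ` heis.level n 0)"
    using assms unfolding recurrent_along_def by (auto dest!: spec[of _ \<epsilon>] bspec[of _ _ "heis.level n 0"])
  obtain g where g: "\<gamma> = embed g" "g \<noteq> 0" using \<gamma>(1) by (auto simp: H3Z_embed simp flip: embed_0)
  obtain s where s: "v = lmat (s * x) (s * z) (s * y)" using \<gamma>(2) by (auto simp: span_lmat)
  have "heis.level n 0 \<inter> heis.act g ` heis.level n 0 \<noteq> {}" using \<gamma>(4) g by auto
  then obtain p where p: "p \<in> heis.level n 0" "heis.act g p \<in> heis.level n 0" by blast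
  then have hz: "hz g = 0" by (rule hz_return)
  show ?thesis using that[OF g(2) p hz, of s] \<gamma>(3) hz by (simp add: g s mat_exp_lmat embed_def)
qed

lemma int_eq_0_if_small: "\<bar>real_of_int k\<bar> < 1 \<Longrightarrow> k = 0"
  by linarith

text \<open>A line that leaves the plane spanned by the \<open>x\<close>- and \<open>y\<close>-directions meets a neighbourhood of
  that plane, where all returns lie, only near the identity.\<close>

lemma not_recurrent_transversal:
  assumes "right_invariant_metric d" "z \<noteq> 0"
  shows "\<not> recurrent_along d heis.M T (span {lmat x z y})"
proof
  assume rec: "recurrent_along d heis.M T (span {lmat x z y})"
  \<comment> \<open>With this choice \<open>\<bar>s * z\<bar> < \<eta>\<close> forces
    \<open>\<bar>s * x\<bar>\<close> and \<open>\<bar>s * y\<bar>\<close> to be at most 1/4. The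
    entries of \<open>g\<close> are then smaller than 1, so these integers vanish.\<close>
  define \<eta> where "\<eta> = 1 / (4 * (1 + \<bar>x / z\<bar> + \<bar>y / z\<bar>))"
  have \<eta>: "\<eta> > 0" "\<eta> \<le> 1/4" "\<eta> * \<bar>x / z\<bar> \<le> 1/4" "\<eta> * \<bar>y / z\<bar> \<le> 1/4"
  proof -
    have "1 + p + q > 0 \<and> 1 / (4 * (1 + p + q)) \<le> 1/4 \<and> 1 / (4 * (1 + p + q)) * p \<le> 1/4 \<and>
        1 / (4 * (1 + p + q)) * q \<le> 1/4" if "p \<ge> 0" "q \<ge> 0" for p q :: real
      using that by (simp add: field_simps)
    from this[of "\<bar>x / z\<bar>" "\<bar>y / z\<bar>"]
    show "\<eta> > 0" "\<eta> \<le> 1/4" "\<eta> * \<bar>x / z\<bar> \<le> 1/4" "\<eta> * \<bar>y / z\<bar> \<le> 1/4"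
      unfolding \<eta>_def by (simp_all only: abs_ge_zero simp_thms zero_less_divide_1_iff zero_less_mult_iff) auto
  qed
  obtain \<epsilon> where \<epsilon>: "\<epsilon> > 0" "\<And>x z y x' z' y'. d (hmat x z y) (hmat x' z' y') < \<epsilon> \<Longrightarrow>
       \<bar>x - x'\<bar> < \<eta> \<and> \<bar>z - z'\<bar> < \<eta> \<and> \<bar>y - y' - (x - x') * z'\<bar> < \<eta>"
    using metric_small[OF assms(1) \<eta>(1)] by blast
  obtain g s where g: "g \<noteq> 0" "hz g = 0"
    "d (hmat (hx g) 0 (hy g)) (hmat (s * x) (s * z) (s * y + s * x * (s * z) / 2)) < \<epsilon>"
    by (rule recurrent_level[OF rec \<epsilon>(1), of 0]) (rule that)
  have near: "\<bar>hx g - s * x\<bar> < \<eta>" "\<bar>s * z\<bar> < \<eta>"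
    "\<bar>hy g - (s * y + s * x * (s * z) / 2) - (hx g - s * x) * (s * z)\<bar> < \<eta>"
    using \<epsilon>(2)[OF g(3)] by auto
  have "\<bar>s * x\<bar> = \<bar>s * z\<bar> * \<bar>x / z\<bar>" "\<bar>s * y\<bar> = \<bar>s * z\<bar> * \<bar>y / z\<bar>"
    using assms(2) by (simp_all add: abs_mult)
  moreover have "\<bar>s * z\<bar> * \<bar>x / z\<bar> \<le> \<eta> * \<bar>x / z\<bar>" "\<bar>s * z\<bar> * \<bar>y / z\<bar> \<le> \<eta> * \<bar>y / z\<bar>"
    using near(2) by (intro mult_right_mono; simp)+
  ultimately have sx: "\<bar>s * x\<bar> \<le> 1/4" and sy: "\<bar>s * y\<bar> \<le> 1/4" using \<eta> by linarith+
  have small: "\<bar>s * z\<bar> \<le> 1/4" "\<bar>hx g - s * x\<bar> \<le> 1/4" using near(1,2) \<eta>(2) by linarith+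
  have "\<bar>s * x * (s * z)\<bar> \<le> 1/4 * (1/4)"
    unfolding abs_mult[of "s * x"] by (rule mult_mono[OF sx small(1)]) auto
  moreover have "\<bar>(hx g - s * x) * (s * z)\<bar> \<le> 1/4 * (1/4)"
    unfolding abs_mult[of "hx g - s * x"] by (rule mult_mono[OF small(2,1)]) auto
  ultimately have "\<bar>hy g\<bar> < (1::real)" using near(3) sy \<eta> by linarith
  moreover have "\<bar>hx g\<bar> < (1::real)" using near(1) sx \<eta> by linarith
  ultimately have "g = 0" using g(2) by (intro heis.expand) (simp add: int_eq_0_if_small)
  with g(1) show False by contradiction
qed

text \<open>A return within 1 of the line in both entries would satisfy
  \<open>\<bar>hy g - t * hx g\<bar> < 1 + \<bar>t\<bar>\<close>, against
  \<open>return_off_slope\<close>.\<close>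

lemma not_recurrent_slope:
  assumes "right_invariant_metric d" "t \<notin> \<int>"
  shows "\<not> recurrent_along d heis.M T (theta t)"
proof
  assume rec: "recurrent_along d heis.M T (theta t)"
  obtain n where n: "\<And>x g. x \<in> heis.level n 0 \<Longrightarrow> heis.act g x \<in> heis.level n 0 \<Longrightarrow> g \<noteq> 0 \<Longrightarrow>
    \<bar>hy g - t * hx g\<bar> \<ge> 1 + \<bar>t\<bar>" using return_off_slope[OF assms(2)] by blast
  obtain \<epsilon> where \<epsilon>: "\<epsilon> > 0" "\<And>x z y x' z' y'. d (hmat x z y) (hmat x' z' y') < \<epsilon> \<Longrightarrow>
       \<bar>x - x'\<bar> < 1 \<and> \<bar>z - z'\<bar> < 1 \<and> \<bar>y - y' - (x - x') * z'\<bar> < 1"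
    using metric_small[OF assms(1), of 1] by auto
  obtain g p s where g: "g \<noteq> 0" "p \<in> heis.level n 0" "heis.act g p \<in> heis.level n 0"
    "d (hmat (hx g) 0 (hy g)) (hmat (s * 1) (s * 0) (s * t + s * 1 * (s * 0) / 2)) < \<epsilon>"
    by (rule recurrent_level[OF rec[unfolded theta_lmat] \<epsilon>(1), of n]) (rule that)
  have near: "\<bar>hx g - s\<bar> < 1" "\<bar>hy g - s * t\<bar> < 1" using \<epsilon>(2)[OF g(4)] by auto
  have "\<bar>t * (hx g - s)\<bar> \<le> \<bar>t\<bar> * 1" unfolding abs_mult using near(1) by (intro mult_left_mono) auto
  moreover have "hy g - t * hx g = (hy g - s * t) - t * (hx g - s)" by (simp add: algebra_simps)
  ultimately show False using near(2) n[OF g(2,3,1)] by linarith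
qed

section \<open>The two recurrence sets\<close>

lemma recurrence_set_T:
  assumes "right_invariant_metric d"
  shows "recurrence_set d heis.M T = {theta (of_int l) | l :: int. True} \<union> {theta_inf}"
proof
  show "recurrence_set d heis.M T \<subseteq> {theta (of_int l) | l :: int. True} \<union> {theta_inf}"
  proof
    fix \<theta> assume "\<theta> \<in> recurrence_set d heis.M T"
    then have \<theta>: "\<theta> \<in> P_h3R" "recurrent_along d heis.M T \<theta>" by (auto simp: recurrence_set_def)
    obtain x z y where v: "\<theta> = span {lmat x z y}" "(x, z, y) \<noteq> (0, 0, 0)" using P_h3R_span \<theta>(1) by blast
    have z: "z = 0" using not_recurrent_transversal[OF assms] \<theta>(2) v(1) by blast
    show "\<theta> \<in> {theta (of_int l) | l :: int. True} \<union> {theta_inf}"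
    proof (cases "x = 0")
      case True
      then have "\<theta> = theta_inf" using z v span_lmat_scale[of y 0 0 1] by (simp add: theta_inf_lmat)
      then show ?thesis by simp
    next
      case False
      then have t: "\<theta> = theta (y / x)" using z v span_lmat_scale[of x 1 0 "y / x"] by (simp add: theta_lmat)
      then have "y / x \<in> \<int>" using not_recurrent_slope[OF assms] \<theta>(2) by blast
      then show ?thesis using t by (auto elim: Ints_cases)
    qed
  qed
  show "{theta (of_int l) | l :: int. True} \<union> {theta_inf} \<subseteq> recurrence_set d heis.M T"
    using recurrent_along_theta[OF assms] recurrent_along_theta_inf[OF assms]
      span_lmat_P[of 1 0] span_lmat_P[of 0 0 1]
    by (auto simp: recurrence_set_def theta_lmat theta_inf_lmat)
qed

lemma even_recurrence_set_T:
  assumes "right_invariant_metric d"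
  shows "even_recurrence_set d heis.M T = {theta_inf}"
proof
  have orbit_inf: "Ad_orbit theta_inf = {theta_inf}"
  proof -
    have "Ad g ` theta_inf = theta_inf" if g: "g \<in> H3R" for g
    proof -
      obtain a c b where "g = hmat a c b" using g by (auto simp: H3R_hmat)
      then show ?thesis by (simp add: theta_inf_lmat Ad_span)
    qed
    then show ?thesis using hmat_H3R[of 0 0 0] unfolding Ad_orbit_def by blast
  qed
  have inf: "theta_inf \<in> recurrence_set d heis.M T" unfolding recurrence_set_T[OF assms] by simp
  then show "{theta_inf} \<subseteq> even_recurrence_set d heis.M T"
    by (simp add: even_recurrence_set_def evenly_recurrent_along_def orbit_inf recurrence_set_def)
  show "even_recurrence_set d heis.M T \<subseteq> {theta_inf}"
  proof
    fix \<theta> assume "\<theta> \<in> even_recurrence_set d heis.M T"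
    then have \<theta>: "\<theta> \<in> P_h3R" "\<And>g. g \<in> H3R \<Longrightarrow> recurrent_along d heis.M T (Ad g ` \<theta>)"
      by (auto simp: even_recurrence_set_def evenly_recurrent_along_def Ad_orbit_def)
    obtain x z y where v: "\<theta> = span {lmat x z y}" using P_h3R_span \<theta>(1) by blast
    have "Ad (hmat 0 0 0) ` \<theta> = \<theta>" by (simp add: v Ad_span)
    then have "\<theta> \<in> recurrence_set d heis.M T"
      using \<theta>(1) \<theta>(2)[of "hmat 0 0 0"] by (simp add: recurrence_set_def)
    then consider l :: int where "\<theta> = theta l" | "\<theta> = theta_inf" unfolding recurrence_set_T[OF assms] by blast
    then show "\<theta> \<in> {theta_inf}"
    proof cases
      case (1 l)
      \<comment> \<open>A real conjugation with half-integral (2,3)-entry moves an integer slope to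
        a non-integer one, along which recurrence fails.\<close>
      have "Ad (hmat 0 (1/2) 0) ` \<theta> = theta (l - 1/2)" by (simp add: 1 theta_lmat Ad_span)
      then have "recurrent_along d heis.M T (theta (l - 1/2))" using \<theta>(2)[of "hmat 0 (1/2) 0"] by simp
      then have "real_of_int l - 1/2 \<in> \<int>" using not_recurrent_slope[OF assms] by blast
      then obtain k :: int where "real_of_int l - 1/2 = k" by (auto elim: Ints_cases)
      then have "real_of_int (2 * l - 2 * k) = real_of_int 1" by simp
      then have "2 * l - 2 * k = 1" by (simp only: of_int_eq_iff)
      then have False by presburger
      then show ?thesis ..
    qed simp
  qed
qed

theorem theorem6p2:
  fixes d :: "real^3^3 \<Rightarrow> real^3^3 \<Rightarrow> real"
  assumes "right_invariant_metric d"
  shows "\<exists>(M :: real measure) T.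
    mp_action M T \<and> emeasure M (space M) = \<infinity> \<and> free_action M T \<and> rank_one M T \<and>
    recurrence_set d M T = {theta (of_int l) | l :: int. True} \<union> {theta_inf} \<and>
    even_recurrence_set d M T = {theta_inf} \<and>
    recurrence_set d M T \<noteq> even_recurrence_set d M T"
proof (intro exI conjI)
  show "mp_action heis.M T" by (rule mp_action_T)
  show "emeasure heis.M (space heis.M) = \<infinity>" using infinite_measure by simp
  show "free_action heis.M T" by (rule free_action_T)
  show "rank_one heis.M T" by (rule rank_one_T)
  show "recurrence_set d heis.M T = {theta (of_int l) | l :: int. True} \<union> {theta_inf}"
    by (rule recurrence_set_T[OF assms])
  show "even_recurrence_set d heis.M T = {theta_inf}" by (rule even_recurrence_set_T[OF assms])
  have "theta (of_int 0) \<in> recurrence_set d heis.M T" unfolding recurrence_set_T[OF assms] by blast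
  then show "recurrence_set d heis.M T \<noteq> even_recurrence_set d heis.M T"
    unfolding even_recurrence_set_T[OF assms] by auto
qed

end
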